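(* For a probability measure $\mu$ on $\mathbb{R}$ let $\Gamma(\mu)=\int\log|x|\,d\mu(x)$, and let $\Gamma(a)=\Gamma(\mu)$ if the random variable $a$ has distribution $\mu$. (a) Among the probability measures $\mu$ on $\mathbb{R}$ with second moment $m_2(\mu)=\int x^2\,d\mu(x)=1$, the measure $p\delta_{-1}+(1-p)\delta_1$ maximizes $\Gamma(\mu)$, for any $p\in[0,1]$. (b) Let $\{a_i\}_{i\ge1}\subset(\mathcal{A},\varphi)$ be a sequence of identically distributed and Boolean independent (self-adjoint) random variables. If $\Gamma(a_1)>-\infty$, then $$\Gamma\left(\frac{a_1+\cdots+a_n}{\sqrt n}\right)$$ is non-decreasing in $n$.
   Context: $(\mathcal{A},\varphi)$ is a noncommutative probability space: here $\mathcal{A}$ is a unital $C^*$-algebra with unit $1_{\mathcal{A}}$ and $\varphi:\mathcal{A}\to\mathbb{C}$ is a state. Elements of $\mathcal{A}$ are called random variables. The distribution of $a=a^*\in\mathcal{A}$ is the unique compactly supported probability measure $\mu_a$ on $\mathbb{R}$ with $\int x^k\,d\mu_a(x)=\varphi(a^k)$ for all $k\ge1$; identically distributed means having the same moments $\varphi(a^k)$, $k\ge 1$. Boolean independence: subalgebras $(\mathcal{A}_k)_{k\ge1}$ of $\mathcal{A}$ (not required to contain $1_{\mathcal{A}}$) are Boolean independent if $\varphi(x_1\cdots x_n)=\prod_{j=1}^n\varphi(x_j)$ whenever $x_j\in\mathcal{A}_{i(j)}$, $x_j\ne 1_{\mathcal{A}}$, and $i(j)\ne i(j+1)$ for $1\le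 j\le n-1$. Random variables $a_1,a_2,\ldots$ are Boolean independent if the (non-unital) algebras $\mathrm{Alg}(a_i)$ generated by $a_i$, i.e. the linear spans of $\{a_i^k:k\ge1\}$, are Boolean independent. $\Gamma$ takes values in $[-\infty,\infty)$ on probability measures with finite second moment ($\log 0=-\infty$). *)

theory Defs
  imports "HOL-Probability.Probability"
begin

(* Unital complex C*-algebras; norm 1 = 1 (from real_normed_algebra_1) only excludes
   the zero algebra, which carries no state. *)
class cstar_algebra = real_normed_algebra_1 + banach +
  fixes scaleC :: "complex \<Rightarrow> 'a \<Rightarrow> 'a"
    and star :: "'a \<Rightarrow> 'a"
  assumes scaleC_add_right: "scaleC c (x + y) = scaleC c x + scaleC c y"
    and scaleC_add_left: "scaleC (c + d) x = scaleC c x + scaleC d x"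
    and scaleC_scaleC: "scaleC c (scaleC d x) = scaleC (c * d) x"
    and scaleC_one: "scaleC 1 x = x"
    and scaleR_scaleC: "r *\<^sub>R x = scaleC (complex_of_real r) x"
    and mult_scaleC_left: "scaleC c x * y = scaleC c (x * y)"
    and mult_scaleC_right: "x * scaleC c y = scaleC c (x * y)"
    and norm_scaleC: "norm (scaleC c x) = cmod c * norm x"
    and star_star: "star (star x) = x"
    and star_add: "star (x + y) = star x + star y"
    and star_scaleC: "star (scaleC c x) = scaleC (cnj c) (star x)"
    and star_mult: "star (x * y) = star y * star x"
    and cstar_identity: "norm (star x * x) = (norm x)\<^sup>2"

definition state :: "('a::cstar_algebra \<Rightarrow> complex) \<Rightarrow> bool" where
  "state \<phi> \<longleftrightarrow>
     Vector_Spaces.linear scaleC (*) \<phi> \<and> (\<forall>x. \<phi> (star x * x) \<in> \<real>\<^sub>\<ge>\<^sub>0) \<and> \<phi> 1 = 1"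

definition self_adjoint :: "'a::cstar_algebra \<Rightarrow> bool" where
  "self_adjoint x \<longleftrightarrow> star x = x"

definition Alg :: "'a::cstar_algebra \<Rightarrow> 'a set" where
  "Alg a = module.span scaleC {a ^ k | k. k \<ge> 1}"

(* Meant for families of subalgebras, not required to contain 1. *)
definition boolean_independent ::
    "('a::cstar_algebra \<Rightarrow> complex) \<Rightarrow> 'i set \<Rightarrow> ('i \<Rightarrow> 'a set) \<Rightarrow> bool" where
  "boolean_independent \<phi> I A \<longleftrightarrow>
     (\<forall>n\<ge>1. \<forall>(i :: nat \<Rightarrow> 'i) (x :: nat \<Rightarrow> 'a).
        (\<forall>j\<in>{1..n}. i j \<in> I \<and> x j \<in> A (i j) \<and> x j \<noteq> 1) \<and>
        (\<forall>j. 1 \<le> j \<and> j \<le> n - 1 \<longrightarrow> i j \<noteq> i (j + 1)) \<longrightarrow>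
        \<phi> (\<Prod>j\<leftarrow>[1..<n+1]. x j) = (\<Prod>j=1..n. \<phi> (x j)))"

definition identically_distributed ::
    "('a::cstar_algebra \<Rightarrow> complex) \<Rightarrow> 'i set \<Rightarrow> ('i \<Rightarrow> 'a) \<Rightarrow> bool" where
  "identically_distributed \<phi> I a \<longleftrightarrow>
     (\<forall>i\<in>I. \<forall>j\<in>I. \<forall>k\<ge>1. \<phi> (a i ^ k) = \<phi> (a j ^ k))"

(* The distribution of a self-adjoint element under a state; existence and uniqueness of
   the compactly supported measure are classical (spectral theorem, moment problem). *)
definition distribution_of :: "('a::cstar_algebra \<Rightarrow> complex) \<Rightarrow> 'a \<Rightarrow> real measure" where
  "distribution_of \<phi> a =
     (THE \<mu>. real_distribution \<mu> \<and>
             (\<exists>K. compact K \<and> emeasure \<mu> (- K) = 0) \<and>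
             (\<forall>k\<ge>1. complex_of_real (\<integral>x. x ^ k \<partial>\<mu>) = \<phi> (a ^ k)))"

definition second_moment :: "real measure \<Rightarrow> ennreal" where
  "second_moment \<mu> = (\<integral>\<^sup>+ x. ennreal (x\<^sup>2) \<partial>\<mu>)"

definition log_abs :: "real \<Rightarrow> ereal" where
  "log_abs x = (if x = 0 then - \<infinity> else ereal (ln \<bar>x\<bar>))"

(* Integral of log|x| as (positive part) - (negative part); e2ennreal truncates negative
   values to 0.  The first integral is finite when the second moment is, so then
   the value lies in [-\<infinity>, \<infinity>). *)
definition Gam :: "real measure \<Rightarrow> ereal" where
  "Gam \<mu> = enn2ereal (\<integral>\<^sup>+ x. e2ennreal (log_abs x) \<partial>\<mu>)
          - enn2ereal (\<integral>\<^sup>+ x. e2ennreal (- log_abs x) \<partial>\<mu>)"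

definition Gam_rv :: "('a::cstar_algebra \<Rightarrow> complex) \<Rightarrow> 'a \<Rightarrow> ereal" where
  "Gam_rv \<phi> a = Gam (distribution_of \<phi> a)"

(* p \<delta>_{-1} + (1 - p) \<delta>_1 *)
definition two_point :: "real \<Rightarrow> real measure" where
  "two_point p = measure_of UNIV (sets borel)
     (\<lambda>A. ennreal p * emeasure (return borel (-1)) A
         + ennreal (1 - p) * emeasure (return borel 1) A)"

end

theory Submission
  imports Defs "HOL-Computational_Algebra.Polynomial" "HOL-Computational_Algebra.Formal_Power_Series"
begin

text \<open>
  Part (a) is the inequality $\log|x| \le (x^2 - 1)/2$, in which equality holds exactly at
  $x = \pm 1$: integrating it against a measure of second moment $1$ gives $\Gamma(\mu) \le 0$
  (\<open>Gam_le_0_of_second_moment\<close>), and the two-point measures have $\Gamma = 0$.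

  For part (b) let $\mu_n$ be the distribution of $T_n = (a_1 + \dots + a_n)/\sqrt n$. The
  monotonicity already holds for every $y > 0$ at the level of
  $I_n(y) = \int (x^2 + y^2)^{-1}\,d\mu_n(x)$: this quantity does not increase with $n$
  (\<open>resolvent_mass_antimono\<close>). Since
  \[ \tfrac12 \int_0^{R^2} \frac{ds}{x^2 + s} = \tfrac12 \log\frac{x^2 + R^2}{x^2}
     = \log R - \log|x| + o(1) \qquad (R \to \infty) \]
  uniformly for $x$ in a bounded set, integrating over $s = y^2$ turns the decrease of $I_n$ into
  the increase of $\Gamma(\mu_n)$ (\<open>Gam_mono_resolvent_mass\<close>).

  The decrease of $I_n$ comes from a variational formula. By the Cauchy--Schwarz inequality
  $1/I_n(y)$ is the infimum of the energy
  $\varphi(\xi^* (T_n^2 + y^2) \xi)$ over all $\xi$ with $\varphi(\xi) = 1$, and it is enough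
  to let $\xi$ run through the polynomials in $T_n$ (\<open>resolvent_mass_lower\<close> and
  \<open>resolvent_mass_attained\<close>). Boolean independence says that $a_j u(a_i)$ vanishes, as a vector
  of the GNS space, whenever $i \ne j$ and $\varphi(u(a_i)) = 0$ (\<open>centered_annihilated\<close>).
  Therefore every polynomial in $T_n$ represents the same vector as some
  $c + u(a_1) + \dots + u(a_n)$ with $u$ centered (\<open>poly_clt_sum_symmetric\<close>). For
  $\xi = 1 + \sum_i u(a_i)$, $h = 1 + u$ and $\Lambda(p) = \varphi(p(a_1))$ the energy is
  \[ \Lambda(x^2 h^2) + (n-1)\,\Lambda(x h)^2 + y^2\,(n \Lambda(h^2) - (n-1)), \]
  which for fixed $h$ does not decrease with $n$, because $\Lambda(h^2) \ge \Lambda(h)^2 = 1$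
  (\<open>resolvent_energy_decreases\<close>). Hence the infimum $1/I_n(y)$ does not decrease either.

  All of this presupposes that the distribution of a self-adjoint element exists and is determined
  by its moments (\<open>distribution_of_self_adjoint\<close>). Uniqueness follows from the Weierstrass
  approximation theorem. For existence, square roots given by the binomial series make a state
  nonnegative on the polynomials $b^k (1-b)^l$, where $b$ is an affine image of the element that
  lies between $0$ and $1$; this is the hypothesis of the Hausdorff moment problem
  (\<open>hausdorff_moment_problem\<close>), whose solution is a weak limit of the discrete measures with
  Bernstein weights.
\<close>

section \<open>Real polynomials in an algebra element\<close>

text \<open>
  The coefficients are real so that the same polynomial can be evaluated at algebra elements and
  at the points of the real line. In a noncommutative algebra evaluation at one fixed element is
  still a homomorphism, so the values of all polynomials there commute.
\<close>

definition poly_at :: "real poly \<Rightarrow> 'b::real_algebra_1 \<Rightarrow> 'b" where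
  "poly_at p a = (\<Sum>i\<le>degree p. coeff p i *\<^sub>R a ^ i)"

lemma poly_at_altdef:
  assumes "degree p \<le> n"
  shows "poly_at p a = (\<Sum>i\<le>n. coeff p i *\<^sub>R a ^ i)"
  unfolding poly_at_def using assms
  by (intro sum.mono_neutral_left) (auto simp: coeff_eq_0)

lemma poly_at_0 [simp]: "poly_at 0 a = 0"
  by (simp add: poly_at_def)

lemma poly_at_add: "poly_at (p + q) a = poly_at p a + poly_at q a"
proof -
  define n where "n = max (degree p) (degree q)"
  have "degree (p + q) \<le> n" unfolding n_def by (rule degree_add_le_max)
  moreover have "degree p \<le> n" "degree q \<le> n" by (auto simp: n_def)
  ultimately show ?thesis
    by (simp add: poly_at_altdef[of _ n] sum.distrib scaleR_add_left)
qed

lemma poly_at_smult: "poly_at (smult c p) a = c *\<^sub>R poly_at p a"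
  by (simp add: poly_at_altdef[OF degree_smult_le] poly_at_def scaleR_sum_right)

lemma poly_at_pCons: "poly_at (pCons c p) a = c *\<^sub>R 1 + a * poly_at p a"
proof -
  have "poly_at (pCons c p) a = (\<Sum>i\<le>Suc (degree p). coeff (pCons c p) i *\<^sub>R a ^ i)"
    by (rule poly_at_altdef) (rule degree_pCons_le)
  also have "\<dots> = c *\<^sub>R 1 + (\<Sum>i\<le>degree p. coeff p i *\<^sub>R a ^ Suc i)"
    by (subst sum.atMost_Suc_shift) simp
  finally show ?thesis
    by (simp add: poly_at_def sum_distrib_left)
qed

lemma poly_at_1 [simp]: "poly_at 1 a = 1"
  by (simp add: poly_at_def)

lemma poly_at_const [simp]: "poly_at [:c:] a = c *\<^sub>R 1"
  by (simp add: poly_at_pCons)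

lemma poly_at_X [simp]: "poly_at [:0, 1:] a = a"
  by (simp add: poly_at_pCons)

lemma poly_at_mult: "poly_at (p * q) a = poly_at p a * poly_at q a"
  by (induction p)
     (simp_all add: poly_at_add poly_at_smult poly_at_pCons algebra_simps)

lemma poly_at_power: "poly_at (p ^ n) a = poly_at p a ^ n"
  by (induction n) (simp_all add: poly_at_mult)

lemma poly_at_diff: "poly_at (p - q) a = poly_at p a - poly_at q a"
  using poly_at_add[of "p - q" q a] by (simp add: algebra_simps)

lemma poly_at_commute: "poly_at p a * poly_at q a = poly_at q a * poly_at p a"
  by (simp add: poly_at_mult[symmetric] mult.commute)

section \<open>Self-adjoint square roots\<close>

lemma star_scaleR: "star (r *\<^sub>R x) = r *\<^sub>R star (x::'a::cstar_algebra)"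
  by (simp add: scaleR_scaleC star_scaleC)

lemma star_1 [simp]: "star (1::'a::cstar_algebra) = 1"
  by (metis mult_1_right star_mult star_star)

lemma linear_star: "linear (star :: 'a::cstar_algebra \<Rightarrow> 'a)"
  by (rule linearI) (auto simp: star_add star_scaleR)

text \<open>
  The C*-identity bounds $\|x\|^2 = \|x^* x\|$ by $\|x^*\|\,\|x\|$; the reverse inequality is the
  same statement for $x^*$.
\<close>

lemma norm_star [simp]: "norm (star (x::'a::cstar_algebra)) = norm x"
proof -
  have le: "norm x \<le> norm (star x)" for x :: 'a
  proof (cases "norm x = 0")
    case False
    have "norm x * norm x \<le> norm (star x) * norm x"
      using cstar_identity[of x] norm_mult_ineq[of "star x" x] by (simp add: power2_eq_square)
    with False show ?thesis by simp
  qed simp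
  show ?thesis using le[of x] le[of "star x"] by (simp add: star_star)
qed

lemma bounded_linear_star: "bounded_linear (star :: 'a::cstar_algebra \<Rightarrow> 'a)"
proof (rule bounded_linear_intro[where K = 1])
qed (auto simp: star_add star_scaleR)

lemma star_power: "star (x ^ n) = star (x::'a::cstar_algebra) ^ n"
  by (induction n) (simp_all add: star_mult power_commutes)

lemma star_poly_at:
  assumes "self_adjoint (a::'a::cstar_algebra)"
  shows "star (poly_at p a) = poly_at p a"
  using assms
  by (simp add: poly_at_def linear_sum[OF linear_star] star_scaleR star_power self_adjoint_def)

text \<open>
  This is $\sqrt{1+x}\,\sqrt{1+x} = 1 + x$, read off coefficientwise from Vandermonde's
  convolution.
\<close>

lemma gbinomial_half_convolution:
  "(\<Sum>i\<le>k. ((1/2::real) gchoose i) * ((1/2) gchoose (k - i))) = (if k \<le> 1 then 1 else 0)"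
proof -
  have "(\<Sum>i\<le>k. ((1/2::real) gchoose i) * ((1/2) gchoose (k - i))) = (1 gchoose k)"
    using gbinomial_Vandermonde[of "1/2::real" "1/2" k] by (simp add: atMost_atLeast0)
  also have "(1::real) gchoose k = real (1 choose k)"
    using binomial_gbinomial[of 1 k, where 'a=real] by simp
  also have "\<dots> = (if k \<le> 1 then 1 else 0)"
    by (auto simp: le_Suc_eq)
  finally show ?thesis .
qed

text \<open>
  The binomial series of $\sqrt{1+x}$ converges absolutely for $\|x\| < 1$, and its Cauchy square
  collapses to $1 + x$ as it does for numbers. Its partial sums are real polynomials in $x$, so
  the limit is self-adjoint and commutes with everything that commutes with $x$.
\<close>

lemma selfadjoint_sqrt:
  fixes x :: "'a::cstar_algebra"
  assumes "norm x < 1" "self_adjoint x"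
  obtains y where "self_adjoint y" "y * y = 1 + x" "\<And>c. c * x = x * c \<Longrightarrow> c * y = y * c"
proof -
  define f where "f i = ((1/2::real) gchoose i) *\<^sub>R x ^ i" for i
  have summ: "summable (\<lambda>i. norm (f i))"
  proof (rule summable_comparison_test)
    \<comment> \<open>convergence at a point strictly between \<open>norm x\<close> and 1 gives absolute convergence at \<open>norm x\<close>\<close>
    have "summable (\<lambda>n. ((1/2::real) gchoose n) * ((1 + norm x)/2) ^ n)"
      using gen_binomial_real[of "(1 + norm x)/2" "1/2"] assms(1) norm_ge_zero[of x]
      by (simp add: sums_iff)
    then show "summable (\<lambda>n. norm (((1/2::real) gchoose n) * norm x ^ n))"
      by (rule powser_insidea) (use assms(1) norm_ge_zero[of x] in \<open>simp\<close>)
    show "\<exists>N. \<forall>n\<ge>N. norm (norm (f n)) \<le> norm (((1/2::real) gchoose n) * norm x ^ n)"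
      by (auto simp: f_def abs_mult norm_power_ineq intro!: mult_left_mono)
  qed
  then have summ': "summable f" by (rule summable_norm_cancel)
  define y where "y = suminf f"
  have "(\<lambda>k. \<Sum>i\<le>k. f i * f (k - i)) sums (y * y)"
    unfolding y_def by (rule Cauchy_product_sums[OF summ summ])
  also have "(\<lambda>k. \<Sum>i\<le>k. f i * f (k - i)) = (\<lambda>k. if k \<in> {0,1} then x ^ k else 0)"
  proof
    fix k
    have "(\<Sum>i\<le>k. f i * f (k - i))
          = (\<Sum>i\<le>k. ((1/2::real) gchoose i) * ((1/2) gchoose (k - i))) *\<^sub>R x ^ k"
      unfolding scaleR_sum_left
      by (intro sum.cong) (auto simp: f_def power_add[symmetric])
    then show "(\<Sum>i\<le>k. f i * f (k - i)) = (if k \<in> {0,1} then x ^ k else 0)"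
      by (simp add: gbinomial_half_convolution le_Suc_eq)
  qed
  finally have "(\<lambda>k. if k \<in> {0,1} then x ^ k else 0) sums (y * y)" .
  moreover have "(\<lambda>k. if k \<in> {0,1} then x ^ k else 0) sums (\<Sum>k\<in>{0,1}. x ^ k)"
    by (rule sums_If_finite_set) simp
  ultimately have "y * y = (\<Sum>k\<in>{0,1::nat}. x ^ k)" by (rule sums_unique2)
  then have sq: "y * y = 1 + x" by simp
  have "star y = (\<Sum>i. star (f i))"
    unfolding y_def using bounded_linear.suminf[OF bounded_linear_star summ'] by simp
  also have "(\<lambda>i. star (f i)) = f"
    using assms(2) by (auto simp: f_def star_scaleR star_power self_adjoint_def)
  finally have "self_adjoint y" by (simp add: y_def self_adjoint_def)
  moreover have "c * y = y * c" if "c * x = x * c" for c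
  proof -
    have "c * x ^ i = x ^ i * c" for i
      using power_commuting_commutes[of x c i] that by simp
    then have "c * f i = f i * c" for i by (simp add: f_def)
    then show ?thesis
      unfolding y_def using summ' by (simp add: suminf_mult[symmetric] suminf_mult2)
  qed
  ultimately show ?thesis using sq that by blast
qed

section \<open>States\<close>

text \<open>
  A state is real on self-adjoint elements, so its real part retains all their moments. It makes
  the algebra a real vector space with the symmetric positive semidefinite form
  $(x, y) \mapsto \mathrm{Re}\,\varphi(x^* y)$.
\<close>

definition re_state :: "('a::cstar_algebra \<Rightarrow> complex) \<Rightarrow> 'a \<Rightarrow> real" where
  "re_state \<phi> x = Re (\<phi> x)"

context
  fixes \<phi> :: "'a::cstar_algebra \<Rightarrow> complex"
  assumes st: "state \<phi>"
begin

lemma state_add: "\<phi> (x + y) = \<phi> x + \<phi> y"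
  and state_scaleC: "\<phi> (scaleC c x) = c * \<phi> x"
  and state_1 [simp]: "\<phi> 1 = 1"
  and state_pos: "\<phi> (star x * x) \<in> \<real>\<^sub>\<ge>\<^sub>0"
  using st unfolding state_def Vector_Spaces.linear_iff by auto

lemma state_scaleR: "\<phi> (r *\<^sub>R x) = of_real r * \<phi> x"
  by (simp add: scaleR_scaleC state_scaleC)

lemma re_state_linear: "linear (re_state \<phi>)"
  by (rule linearI) (auto simp: re_state_def state_add state_scaleR)

lemmas re_state_add = linear_add[OF re_state_linear]
  and re_state_diff = linear_diff[OF re_state_linear]
  and re_state_scaleR = linear_scale[OF re_state_linear]
  and re_state_sum = linear_sum[OF re_state_linear]
  and re_state_0 = linear_0[OF re_state_linear]

lemma re_state_1 [simp]: "re_state \<phi> 1 = 1"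
  by (simp add: re_state_def)

lemma re_state_pos: "re_state \<phi> (star x * x) \<ge> 0"
  using state_pos[of x] by (auto simp: re_state_def complex_nonneg_Reals_iff)

text \<open>
  Polarization: positivity makes $\varphi(y^* y)$ real for $y = 1 + i x$, and the imaginary part
  of its expansion is the difference of the real parts of $\varphi(x)$ and $\varphi(x^*)$.
\<close>

lemma re_state_star: "re_state \<phi> (star x) = re_state \<phi> x"
proof -
  define y where "y = 1 + scaleC \<i> x"
  have "star y * y = 1 + scaleC \<i> x + scaleC (-\<i>) (star x) + star x * x"
    by (simp add: y_def star_add star_scaleC algebra_simps mult_scaleC_left mult_scaleC_right
        scaleC_scaleC scaleC_one scaleC_add_right)
  then have "\<phi> (star y * y) = 1 + \<i> * \<phi> x - \<i> * \<phi> (star x) + \<phi> (star x * x)"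
    by (simp add: state_add state_scaleC)
  moreover have "Im (\<phi> (star y * y)) = 0" "Im (\<phi> (star x * x)) = 0"
    using state_pos[of y] state_pos[of x] by (auto simp: complex_nonneg_Reals_iff)
  ultimately show ?thesis
    by (simp add: re_state_def)
qed

text \<open>
  The quadratic polynomial $t \mapsto \varphi((t x + y)^* (t x + y))$ is nonnegative. When its
  leading coefficient vanishes it is affine, hence constant.
\<close>

lemma re_state_cauchy_schwarz:
  "(re_state \<phi> (star x * y))\<^sup>2 \<le> re_state \<phi> (star x * x) * re_state \<phi> (star y * y)"
proof -
  define b where "b = re_state \<phi> (star x * y)"
  have sym: "re_state \<phi> (star y * x) = b"
    using re_state_star[of "star x * y"] by (simp add: b_def star_mult star_star)
  have q: "0 \<le> re_state \<phi> (star x * x) * t\<^sup>2 + 2 * b * t + re_state \<phi> (star y * y)" for t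
  proof -
    have "star (t *\<^sub>R x + y) * (t *\<^sub>R x + y)
          = (t\<^sup>2) *\<^sub>R (star x * x) + t *\<^sub>R (star x * y) + t *\<^sub>R (star y * x) + star y * y"
      by (simp add: star_add star_scaleR algebra_simps power2_eq_square)
    then show ?thesis
      using re_state_pos[of "t *\<^sub>R x + y"] sym
      by (simp add: re_state_add re_state_scaleR b_def algebra_simps)
  qed
  have p: "re_state \<phi> (star x * x) \<ge> 0" by (rule re_state_pos)
  show ?thesis
  proof (cases "re_state \<phi> (star x * x) = 0")
    case True
    \<comment> \<open>otherwise the affine function takes the value $-1$\<close>
    have "b = 0"
    proof (rule ccontr)
      assume "b \<noteq> 0"
      have "0 \<le> re_state \<phi> (star y * y) + 2 * b * (-(re_state \<phi> (star y * y) + 1) / (2 * b))"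
        using q[of "-(re_state \<phi> (star y * y) + 1) / (2 * b)"] True by simp
      with \<open>b \<noteq> 0\<close> show False by (simp add: field_simps)
    qed
    with True show ?thesis by (simp add: b_def)
  next
    case False
    with p have p': "re_state \<phi> (star x * x) > 0" by simp
    have "0 \<le> re_state \<phi> (star y * y) - b\<^sup>2 / re_state \<phi> (star x * x)"
      using q[of "- b / re_state \<phi> (star x * x)"] p' by (simp add: field_simps power2_eq_square)
    then show ?thesis using p' by (simp add: b_def field_simps)
  qed
qed

text \<open>
  Polarization again, now with $1 + x$ in place of $1 + i x$.
\<close>

lemma state_self_adjoint:
  assumes "star x = x"
  shows "\<phi> x = of_real (re_state \<phi> x)"
proof -
  have "star (1 + x) * (1 + x) = 1 + x + x + star x * x"
    using assms by (simp add: star_add algebra_simps)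
  then have "\<phi> (star (1 + x) * (1 + x)) = 1 + 2 * \<phi> x + \<phi> (star x * x)"
    by (simp add: state_add)
  moreover have "Im (\<phi> (star (1 + x) * (1 + x))) = 0" "Im (\<phi> (star x * x)) = 0"
    using state_pos[of "1 + x"] state_pos[of x] by (auto simp: complex_nonneg_Reals_iff)
  ultimately show ?thesis
    by (simp add: re_state_def complex_eq_iff)
qed

text \<open>
  The two affine images $(K \pm a)/(2K)$ of $a$ are squares of commuting self-adjoint elements
  $z$ and $y$ up to a factor, so the product of their powers is a multiple of
  $(z^k y^l)^* (z^k y^l)$. They are the images of $b$ and $1 - b$ under $b = (K + a)/(2K)$.
\<close>

lemma state_power_positive:
  assumes sa: "self_adjoint a" and K: "norm a < K"
  shows "\<phi> (poly_at ([:1/2, 1/(2*K):] ^ k * [:1/2, -1/(2*K):] ^ l) a) \<in> \<real>\<^sub>\<ge>\<^sub>0"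
proof -
  have K0: "K > 0" using K norm_ge_zero[of a] by linarith
  have n1: "norm ((1/K) *\<^sub>R a) < 1" "norm ((-1/K) *\<^sub>R a) < 1"
    using K K0 by (auto simp: field_simps)
  have s1: "self_adjoint ((1/K) *\<^sub>R a)" "self_adjoint ((-1/K) *\<^sub>R a)"
    using sa by (auto simp: self_adjoint_def star_scaleR simp del: scaleR_minus_left)
  obtain z where z: "self_adjoint z" "z * z = 1 + (1/K) *\<^sub>R a"
      "\<And>c. c * ((1/K) *\<^sub>R a) = ((1/K) *\<^sub>R a) * c \<Longrightarrow> c * z = z * c"
    using selfadjoint_sqrt[OF n1(1) s1(1)] by metis
  obtain y where y: "self_adjoint y" "y * y = 1 + (-1/K) *\<^sub>R a"
      "\<And>c. c * ((-1/K) *\<^sub>R a) = ((-1/K) *\<^sub>R a) * c \<Longrightarrow> c * y = y * c"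
    using selfadjoint_sqrt[OF n1(2) s1(2)] by metis
  have "a * z = z * a" by (rule z(3)) simp
  then have "z * y = y * z" by (intro y(3)) simp
  then have com: "z ^ k * y ^ l = y ^ l * z ^ k"
    by (metis power_commuting_commutes)
  have "star (z ^ k * y ^ l) * (z ^ k * y ^ l) = (z ^ k * z ^ k) * (y ^ l * y ^ l)"
    using z(1) y(1) com by (simp add: star_mult star_power self_adjoint_def) (metis com mult.assoc)
  also have "\<dots> = (z * z) ^ k * (y * y) ^ l"
    by (simp add: power_add[symmetric] power_mult[symmetric] mult_2 mult_2_right power2_eq_square[symmetric])
  finally have sq: "star (z ^ k * y ^ l) * (z ^ k * y ^ l) = (z * z) ^ k * (y * y) ^ l" .
  have "poly_at [:1/2, 1/(2*K):] a = (1/2) *\<^sub>R (z * z)"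
    "poly_at [:1/2, -1/(2*K):] a = (1/2) *\<^sub>R (y * y)"
    by (auto simp: poly_at_pCons z(2) y(2) scaleR_add_right scaleR_diff_right)
  then have "poly_at ([:1/2, 1/(2*K):] ^ k * [:1/2, -1/(2*K):] ^ l) a
     = ((1/2)^k * (1/2)^l) *\<^sub>R (star (z ^ k * y ^ l) * (z ^ k * y ^ l))"
    by (simp add: poly_at_mult poly_at_power scaleR_power sq mult.commute)
  then have "\<phi> (poly_at ([:1/2, 1/(2*K):] ^ k * [:1/2, -1/(2*K):] ^ l) a)
     = of_real ((1/2)^k * (1/2)^l) * \<phi> (star (z ^ k * y ^ l) * (z ^ k * y ^ l))"
    by (simp only: state_scaleR)
  also have "\<dots> \<in> \<real>\<^sub>\<ge>\<^sub>0"
    by (intro nonneg_Reals_mult_I state_pos) simp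
  finally show ?thesis .
qed

end

section \<open>The Hausdorff moment problem\<close>

lemma pcompose_power: "pcompose (p ^ n) q = pcompose p q ^ n" for p :: "'b::comm_semiring_1 poly"
  by (induction n) (simp_all add: pcompose_mult pcompose_1)

text \<open>
  For $x + y = 1$ this is the $m$-th factorial moment of the binomial distribution, as a
  polynomial identity. It follows from
  $\binom{N}{k}\binom{k}{m} = \binom{N}{m}\binom{N-m}{k-m}$ and the binomial theorem.
\<close>

lemma binomial_factorial_moment:
  fixes x y :: "'b::comm_semiring_1"
  assumes "m \<le> N"
  shows "(\<Sum>k\<le>N. of_nat (k choose m) * (of_nat (N choose k) * x ^ k * y ^ (N - k)))
         = of_nat (N choose m) * x ^ m * (x + y) ^ (N - m)"
proof -
  have "(\<Sum>k\<le>N. of_nat (k choose m) * (of_nat (N choose k) * x ^ k * y ^ (N - k)))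
      = (\<Sum>k\<in>{m..N}. of_nat (k choose m) * (of_nat (N choose k) * x ^ k * y ^ (N - k)))"
    by (intro sum.mono_neutral_right) (auto simp: binomial_eq_0)
  also have "\<dots> = (\<Sum>j\<le>N - m. of_nat ((m + j) choose m) *
                  (of_nat (N choose (m + j)) * x ^ (m + j) * y ^ (N - (m + j))))"
    using assms
    by (intro sum.reindex_bij_witness[of _ "\<lambda>j. m + j" "\<lambda>k. k - m"]) auto
  also have "\<dots> = (\<Sum>j\<le>N - m. of_nat (N choose m) * x ^ m *
                  (of_nat ((N - m) choose j) * x ^ j * y ^ (N - m - j)))"
  proof (intro sum.cong refl)
    fix j assume "j \<in> {..N - m}"
    then have "(N choose (m + j)) * ((m + j) choose m) = (N choose m) * ((N - m) choose j)"
      using choose_mult[of m "m + j" N] assms by simp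
    then have "(of_nat (N choose (m + j)) * of_nat ((m + j) choose m) :: 'b)
        = of_nat (N choose m) * of_nat ((N - m) choose j)"
      by (metis of_nat_mult)
    moreover have "of_nat ((m + j) choose m) * (of_nat (N choose (m + j)) * x ^ (m + j) * y ^ (N - (m + j)))
        = (of_nat (N choose (m + j)) * of_nat ((m + j) choose m)) * (x ^ m * x ^ j * y ^ (N - m - j))"
      by (simp only: power_add diff_diff_left mult_ac)
    ultimately show "of_nat ((m + j) choose m) * (of_nat (N choose (m + j)) * x ^ (m + j) * y ^ (N - (m + j)))
        = of_nat (N choose m) * x ^ m * (of_nat ((N - m) choose j) * x ^ j * y ^ (N - m - j))"
      by (simp only: mult_ac)
  qed
  also have "\<dots> = of_nat (N choose m) * x ^ m * (x + y) ^ (N - m)"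
    by (simp add: binomial_ring sum_distrib_left)
  finally show ?thesis .
qed

text \<open>
  Powers $(k/N)^m$ are the moments of a measure on the points $k/N$, while the binomial identity
  gives its factorial moments. Both are products of $m$ factors in $[-1, 1]$, and corresponding
  factors $k/N$ and $(k-j)/(N-j)$ differ by at most $j/(N-j)$; the bound is uniform in $k$ and
  vanishes as $N \to \infty$.
\<close>

lemma binomial_ratio_approx:
  assumes "k \<le> N" "2 * m \<le> N" "1 \<le> N"
  shows "\<bar>(real k / N) ^ m - (k choose m) / (N choose m)\<bar> \<le> (\<Sum>j<m. real j / (real N - real j))"
proof -
  have eq: "real (k choose m) / (N choose m) = (\<Prod>j<m. (real k - j) / (real N - j))"
    by (simp add: binomial_gbinomial gbinomial_prod_rev prod_dividef atLeast0LessThan)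
  \<comment> \<open>the assumption $2m \le N$ keeps the factors with $k < j$, which are negative, above $-1$\<close>
  have "\<bar>(\<Prod>j<m. real k / N) - (\<Prod>j<m. (real k - j) / (real N - j))\<bar>
      \<le> (\<Sum>j<m. \<bar>real k / N - (real k - j) / (real N - j)\<bar>)"
  proof (rule norm_prod_diff[where 'a=real, unfolded real_norm_def])
    fix j assume "j \<in> {..<m}"
    then have j: "real j < real N - real j" using assms(2) by auto
    show "\<bar>(real k - j) / (real N - j)\<bar> \<le> 1"
      using j assms(1) by (auto simp: abs_le_iff divide_simps)
  qed (use assms in auto)
  also have "\<dots> \<le> (\<Sum>j<m. real j / (real N - real j))"
  proof (intro sum_mono)
    fix j assume "j \<in> {..<m}"
    then have j: "real j < real N - real j" "real N > 0" using assms by auto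
    have "real k / N - (real k - j) / (real N - j) = (real j / (real N - j)) * (1 - real k / real N)"
      using j by (simp add: field_simps)
    also have "\<bar>\<dots>\<bar> \<le> (real j / (real N - j)) * 1"
      unfolding abs_mult using j assms(1) by (intro mult_mono) auto
    finally show "\<bar>real k / N - (real k - j) / (real N - j)\<bar> \<le> real j / (real N - real j)"
      using j by (simp add: of_nat_diff)
  qed
  finally show ?thesis unfolding eq by simp
qed

lemma poly_functional_expand:
  fixes L :: "real poly \<Rightarrow> real"
  assumes add: "\<And>p q. L (p + q) = L p + L q"
    and smult: "\<And>c p. L (smult c p) = c * L p"
  shows "L p = (\<Sum>i\<le>degree p. coeff p i * L ([:0, 1:] ^ i))"
proof -
  have L0: "L 0 = 0" using smult[of 0 0] by simp
  have "L (\<Sum>i\<in>A. f i) = (\<Sum>i\<in>A. L (f i))" for A :: "nat set" and f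
    by (induction A rule: infinite_finite_induct) (auto simp: L0 add)
  then have "L (\<Sum>i\<le>degree p. monom (coeff p i) i) = (\<Sum>i\<le>degree p. coeff p i * L ([:0, 1:] ^ i))"
    by (simp add: monom_altdef smult)
  then show ?thesis by (simp add: poly_as_sum_of_monoms)
qed

text \<open>
  Nonnegativity on $X^k (1-X)^{N-k}$ turns the Bernstein coefficients into weights $w_{N,k}$ of
  a probability measure on the points $k/N$. These measures live on $[0, 1]$, hence are tight, and
  Helly's theorem provides a weak limit. Their factorial moments agree exactly with those
  prescribed by $L$, so their ordinary moments converge to the prescribed ones.
\<close>

theorem hausdorff_moment_problem:
  fixes L :: "real poly \<Rightarrow> real"
  assumes add: "\<And>p q. L (p + q) = L p + L q"
    and smult: "\<And>c p. L (smult c p) = c * L p"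
    and one: "L 1 = 1"
    and pos: "\<And>k l. L ([:0, 1:] ^ k * [:1, -1:] ^ l) \<ge> 0"
  obtains M where "real_distribution M" "AE x in M. x \<in> {0..1}" "\<And>p. (\<integral>x. poly p x \<partial>M) = L p"
proof -
  have L0: "L 0 = 0" using smult[of 0 0] by simp
  have Lsum: "L (\<Sum>i\<in>A. f i) = (\<Sum>i\<in>A. L (f i))" for A :: "nat set" and f
    by (induction A rule: infinite_finite_induct) (auto simp: L0 add)
  define w where "w N k = real (N choose k) * L ([:0, 1:] ^ k * [:1, -1:] ^ (N - k))" for N k
  have w0: "w N k \<ge> 0" for N k by (simp add: w_def pos)
  have fm: "(\<Sum>k\<le>N. w N k * real (k choose m)) = real (N choose m) * L ([:0, 1:] ^ m)" if "m \<le> N" for N m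
  proof -
    have "(\<Sum>k\<le>N. smult (real (k choose m) * real (N choose k)) ([:0, 1:] ^ k * [:1, -1:] ^ (N - k)))
        = (smult (real (N choose m)) ([:0, 1:] ^ m) :: real poly)"
    proof -
      have "[:0, 1:] + [:1, -1:] = (1 :: real poly)" by (simp add: one_pCons)
      then show ?thesis
        using binomial_factorial_moment[OF that, of "[:0, 1:] :: real poly" "[:1, -1:]"]
        by (simp add: of_nat_poly one_pCons[symmetric] mult.assoc mult.commute[of "real (N choose _)"])
    qed
    then have "L (\<Sum>k\<le>N. smult (real (k choose m) * real (N choose k)) ([:0, 1:] ^ k * [:1, -1:] ^ (N - k)))
        = real (N choose m) * L ([:0, 1:] ^ m)" by (simp add: smult)
    then show ?thesis
      by (simp add: Lsum smult w_def mult_ac)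
  qed
  have w1: "(\<Sum>k\<le>N. w N k) = 1" for N
    using fm[of 0 N] by (simp add: one)
  \<comment> \<open>the weights live on the indices; $\mu_N$ is their image under $k \mapsto k/N$\<close>
  define P where "P N = point_measure {..N} (\<lambda>k. ennreal (w N k))" for N
  define \<mu> where "\<mu> N = distr (P N) borel (\<lambda>k. real k / real N)" for N
  have spP: "space (P N) = {..N}" "sets (P N) = Pow {..N}" for N
    by (auto simp: P_def space_point_measure sets_point_measure)
  have measP: "(g :: nat \<Rightarrow> real) \<in> borel_measurable (P N)" for g N
    by (auto simp: measurable_def spP)
  have probP: "prob_space (P N)" for N
  proof
    show "emeasure (P N) (space (P N)) = 1"
      unfolding spP by (simp add: P_def emeasure_point_measure_finite w0 w1 sum_ennreal)
  qed
  have int_\<mu>: "(\<integral>x. f x \<partial>\<mu> N) = (\<Sum>k\<le>N. w N k * f (real k / N))"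
    if "f \<in> borel_measurable borel" for f :: "real \<Rightarrow> real" and N
    unfolding \<mu>_def using that
    by (subst integral_distr) (auto simp: measP P_def lebesgue_integral_point_measure_finite w0)
  have rd: "real_distribution (\<mu> N)" for N
    unfolding \<mu>_def by (rule prob_space.real_distribution_distr[OF probP measP])
  have "tight \<mu>"
    unfolding tight_def
  proof (intro conjI allI impI rd)
    fix \<epsilon> :: real assume "\<epsilon> > 0"
    have "measure (\<mu> N) {-1<..1} = 1" for N
    proof -
      have "(\<lambda>k. real k / real N) -` {-1<..1} \<inter> space (P N) = space (P N)"
      proof -
        have "-1 < real k / real N" for k
        proof -
          have "0 \<le> real k / real N" by simp
          then show ?thesis by linarith
        qed
        then show ?thesis by (auto simp: spP divide_le_eq_1)
      qed
      then show ?thesis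
        unfolding \<mu>_def by (simp add: measure_distr measP prob_space.prob_space[OF probP])
    qed
    then show "\<exists>a b. a < b \<and> (\<forall>n. 1 - \<epsilon> < measure (\<mu> n) {a<..b})"
      using \<open>\<epsilon> > 0\<close> by (intro exI[of _ "-1"] exI[of _ 1]) auto
  qed
  then obtain r M where r: "strict_mono (r :: nat \<Rightarrow> nat)" and M: "real_distribution M"
    and "weak_conv_m (\<mu> \<circ> id \<circ> r) M"
    using tight_imp_convergent_subsubsequence[of \<mu> id] by (auto simp: strict_mono_id)
  then have wc: "weak_conv_m (\<lambda>n. \<mu> (r n)) M" by (simp add: comp_def)
  interpret M: real_distribution M by fact
  have lim: "(\<lambda>n. \<integral>x. f x \<partial>\<mu> (r n)) \<longlonglongrightarrow> (\<integral>x. f x \<partial>M)"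
    if "continuous_on UNIV f" "\<And>x. \<bar>f x\<bar> \<le> 1" for f :: "real \<Rightarrow> real"
    using weak_conv_imp_integral_bdd_continuous_conv[OF rd M wc, of f 1] that
    by (auto simp: continuous_on_eq_continuous_at)
  \<comment> \<open>weak convergence tests bounded functions only, so powers are composed with the retraction onto $[0, 1]$\<close>
  define c where "c x = max 0 (min 1 x)" for x :: real
  have c_cont: "continuous_on UNIV c" unfolding c_def by (intro continuous_intros)
  have c01: "0 \<le> c x" "c x \<le> 1" for x by (auto simp: c_def)
  have c_id: "c (real k / real N) = real k / real N" if "k \<le> N" for k N
  proof -
    have "real k / real N \<le> 1" using that by (auto simp: divide_le_eq_1)
    then show ?thesis by (simp add: c_def)
  qed
  have AE01: "AE x in M. x \<in> {0..1}"
  proof -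
    \<comment> \<open>a bounded continuous function that vanishes exactly on $[0, 1]$\<close>
    define f where "f x = min 1 \<bar>x - c x\<bar>" for x
    have fc: "continuous_on UNIV f" unfolding f_def by (intro continuous_intros c_cont)
    have fb: "\<bar>f x\<bar> \<le> 1" for x by (auto simp: f_def)
    have [measurable]: "f \<in> borel_measurable borel" by (rule borel_measurable_continuous_onI[OF fc])
    have "(\<integral>x. f x \<partial>\<mu> N) = 0" for N
      by (subst int_\<mu>) (auto simp: f_def c_id intro!: sum.neutral)
    then have "(\<integral>x. f x \<partial>M) = 0"
      using lim[OF fc fb] by (simp add: LIMSEQ_const_iff)
    moreover have "integrable M f"
      by (rule M.integrable_const_bound[of _ 1]) (auto simp: fb)
    ultimately have "AE x in M. f x = 0"
      by (subst (asm) integral_nonneg_eq_0_iff_AE) (auto simp: f_def)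
    then show ?thesis by eventually_elim (auto simp: f_def c_def min_def max_def split: if_splits)
  qed
  have mom: "(\<integral>x. x ^ m \<partial>M) = L ([:0, 1:] ^ m)" for m
  proof -
    have cont: "continuous_on UNIV (\<lambda>x. c x ^ m)" by (intro continuous_intros c_cont)
    have [measurable]: "(\<lambda>x. c x ^ m) \<in> borel_measurable borel"
      by (rule borel_measurable_continuous_onI[OF cont])
    have eqM: "(\<integral>x. c x ^ m \<partial>M) = (\<integral>x. x ^ m \<partial>M)"
    proof (rule integral_cong_AE)
      show "AE x in M. c x ^ m = x ^ m"
        using AE01 by eventually_elim (auto simp: c_def)
    qed auto
    have 1: "(\<lambda>n. \<integral>x. c x ^ m \<partial>\<mu> (r n)) \<longlonglongrightarrow> (\<integral>x. x ^ m \<partial>M)"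
      unfolding eqM[symmetric] by (rule lim[OF cont]) (auto simp: c01 power_le_one)
    have "(\<lambda>N. (\<Sum>k\<le>N. w N k * (real k / N) ^ m) - L ([:0, 1:] ^ m)) \<longlonglongrightarrow> 0"
    proof (rule Lim_null_comparison)
      show "\<forall>\<^sub>F N in sequentially.
         norm ((\<Sum>k\<le>N. w N k * (real k / N) ^ m) - L ([:0, 1:] ^ m)) \<le> (\<Sum>j<m. real j / (real N - real j))"
        using eventually_ge_at_top[of "Suc (2 * m)"]
      proof eventually_elim
        case (elim N)
        have ch: "real (N choose m) > 0" using elim by (simp add: zero_less_binomial_iff)
        have "L ([:0, 1:] ^ m) = (\<Sum>k\<le>N. w N k * real (k choose m)) / real (N choose m)"
          using fm[of m N] elim ch by simp
        then have "(\<Sum>k\<le>N. w N k * (real k / N) ^ m) - L ([:0, 1:] ^ m)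
            = (\<Sum>k\<le>N. w N k * ((real k / N) ^ m - (k choose m) / (N choose m)))"
          by (simp add: right_diff_distrib sum_subtractf sum_divide_distrib)
        also have "\<bar>\<dots>\<bar> \<le> (\<Sum>k\<le>N. w N k * (\<Sum>j<m. real j / (real N - real j)))"
        proof (rule order.trans[OF sum_abs sum_mono])
          fix k assume "k \<in> {..N}"
          then show "\<bar>w N k * ((real k / N) ^ m - (k choose m) / (N choose m))\<bar>
              \<le> w N k * (\<Sum>j<m. real j / (real N - real j))"
            unfolding abs_mult using binomial_ratio_approx[of k N m] elim w0
            by (intro mult_mono) auto
        qed
        also have "\<dots> = (\<Sum>j<m. real j / (real N - real j))"
          by (simp add: sum_distrib_right[symmetric] w1)
        finally show ?case by simp
      qed
      show "(\<lambda>N. \<Sum>j<m. real j / (real N - real j)) \<longlonglongrightarrow> 0"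
      proof (rule tendsto_null_sum)
        fix j
        have "(\<lambda>N. real j / (real (N + j) - real j)) \<longlonglongrightarrow> 0"
          by (simp add: lim_const_over_n)
        then show "(\<lambda>N. real j / (real N - real j)) \<longlonglongrightarrow> 0"
          by (rule LIMSEQ_offset)
      qed
    qed
    then have "(\<lambda>N. \<Sum>k\<le>N. w N k * (real k / N) ^ m) \<longlonglongrightarrow> L ([:0, 1:] ^ m)"
      by (simp add: LIM_zero_iff)
    moreover have "(\<Sum>k\<le>N. w N k * (real k / N) ^ m) = (\<integral>x. c x ^ m \<partial>\<mu> N)" for N
      by (subst int_\<mu>) (auto simp: c_id)
    ultimately have "(\<lambda>N. \<integral>x. c x ^ m \<partial>\<mu> N) \<longlonglongrightarrow> L ([:0, 1:] ^ m)" by simp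
    from LIMSEQ_subseq_LIMSEQ[OF this r] have "(\<lambda>n. \<integral>x. c x ^ m \<partial>\<mu> (r n)) \<longlonglongrightarrow> L ([:0, 1:] ^ m)"
      by (simp add: comp_def)
    with 1 show ?thesis by (rule LIMSEQ_unique)
  qed
  have "(\<integral>x. poly p x \<partial>M) = L p" for p
  proof -
    have "integrable M (\<lambda>x. x ^ i)" for i
      by (rule M.integrable_const_bound[of _ 1], rule AE_mp[OF AE01])
         (auto simp: power_le_one)
    then have "(\<integral>x. poly p x \<partial>M) = (\<Sum>i\<le>degree p. coeff p i * (\<integral>x. x ^ i \<partial>M))"
      by (simp add: poly_altdef)
    also have "\<dots> = L p"
      by (simp add: mom poly_functional_expand[OF add smult, of p])
    finally show ?thesis .
  qed
  with M AE01 show ?thesis by (rule that)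
qed

section \<open>Distributions of self-adjoint elements\<close>

lemma poly_uniform_approx:
  fixes f :: "real \<Rightarrow> real"
  assumes "continuous_on {-K..K} f" "e > 0"
  obtains p :: "real poly" where "\<And>x. \<bar>x\<bar> \<le> K \<Longrightarrow> \<bar>f x - poly p x\<bar> < e"
proof -
  obtain g where g: "real_polynomial_function g" "\<And>x. x \<in> {-K..K} \<Longrightarrow> \<bar>f x - g x\<bar> < e"
    using Stone_Weierstrass_real_polynomial_function[of "{-K..K}" f e] assms by auto
  obtain a n where "g = (\<lambda>x. \<Sum>i\<le>n. a i * x ^ i)"
    using g(1) by (auto simp: real_polynomial_function_iff_sum)
  then have "g = poly (\<Sum>i\<le>n. monom (a i) i)"
    by (auto simp: poly_sum poly_monom)
  with g(2) have "\<bar>f x - poly (\<Sum>i\<le>n. monom (a i) i) x\<bar> < e" if "\<bar>x\<bar> \<le> K" for x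
    using that by (auto simp: abs_le_iff)
  then show ?thesis by (rule that)
qed

lemma (in real_distribution) integrable_bounded_support:
  assumes "AE x in M. \<bar>x\<bar> \<le> K" "continuous_on {-K..K} f" "f \<in> borel_measurable borel"
  shows "integrable M (f :: real \<Rightarrow> real)"
proof -
  have "bounded (f ` {-K..K})"
    by (intro compact_imp_bounded compact_continuous_image assms) auto
  then obtain B where B: "\<And>x. x \<in> {-K..K} \<Longrightarrow> norm (f x) \<le> B"
    unfolding bounded_iff by blast
  have m: "f \<in> borel_measurable M" using assms(3) by simp
  show ?thesis
  proof (rule integrable_const_bound[OF _ m])
    show "AE x in M. norm (f x) \<le> B"
      using assms(1) by eventually_elim (rule B, auto simp: abs_le_iff)
  qed
qed

lemma bounded_support_integral_unique:
  fixes f :: "real \<Rightarrow> real"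
  assumes "real_distribution M1" "real_distribution M2"
    and b: "AE x in M1. \<bar>x\<bar> \<le> K" "AE x in M2. \<bar>x\<bar> \<le> K"
    and mom: "\<And>p. (\<integral>x. poly p x \<partial>M1) = (\<integral>x. poly p x \<partial>M2)"
    and f: "continuous_on UNIV f"
  shows "(\<integral>x. f x \<partial>M1) = (\<integral>x. f x \<partial>M2)"
proof (rule ccontr)
  interpret M1: real_distribution M1 by fact
  interpret M2: real_distribution M2 by fact
  assume ne: "(\<integral>x. f x \<partial>M1) \<noteq> (\<integral>x. f x \<partial>M2)"
  define e where "e = \<bar>(\<integral>x. f x \<partial>M1) - (\<integral>x. f x \<partial>M2)\<bar> / 3"
  have e: "e > 0" using ne by (simp add: e_def)
  obtain p where p: "\<And>x. \<bar>x\<bar> \<le> K \<Longrightarrow> \<bar>f x - poly p x\<bar> < e"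
    using poly_uniform_approx[of K f e] e continuous_on_subset[OF f] by auto
  have [measurable]: "f \<in> borel_measurable borel" by (rule borel_measurable_continuous_onI[OF f])
  have [measurable]: "poly p \<in> borel_measurable borel"
    by (intro borel_measurable_continuous_onI continuous_intros)
  have app: "\<bar>(\<integral>x. f x \<partial>N) - (\<integral>x. poly p x \<partial>N)\<bar> \<le> e"
    if "real_distribution N" "AE x in N. \<bar>x\<bar> \<le> K" for N
  proof -
    interpret N: real_distribution N by fact
    have i: "integrable N f" "integrable N (poly p)"
      using that(2) continuous_on_subset[OF f]
      by (auto intro!: N.integrable_bounded_support[where K = K] continuous_intros)
    then have "\<bar>(\<integral>x. f x \<partial>N) - (\<integral>x. poly p x \<partial>N)\<bar> = \<bar>\<integral>x. f x - poly p x \<partial>N\<bar>" by simp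
    also have "\<dots> \<le> (\<integral>x. \<bar>f x - poly p x\<bar> \<partial>N)" by (rule integral_abs_bound)
    also have "\<dots> \<le> (\<integral>x. e \<partial>N)"
    proof (rule integral_mono_AE)
      show "AE x in N. \<bar>f x - poly p x\<bar> \<le> e"
        using that(2) by eventually_elim (use p in \<open>force intro: less_imp_le\<close>)
    qed (use i in auto)
    also have "\<dots> = e" by (simp add: N.prob_space[unfolded N.space_eq_univ])
    finally show ?thesis .
  qed
  have "\<bar>(\<integral>x. f x \<partial>M1) - (\<integral>x. f x \<partial>M2)\<bar> \<le> 2 * e"
    using app[OF assms(1) b(1)] app[OF assms(2) b(2)] mom[of p] by linarith
  moreover have "\<bar>(\<integral>x. f x \<partial>M1) - (\<integral>x. f x \<partial>M2)\<bar> = 3 * e" by (simp add: e_def)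
  ultimately show False using e by linarith
qed

text \<open>
  By uniform polynomial approximation the moments determine the integrals of $\cos(tx)$ and
  $\sin(tx)$, and thus the characteristic function.
\<close>

lemma bounded_support_moments_unique:
  assumes M: "real_distribution M1" "real_distribution M2"
    and b: "AE x in M1. \<bar>x\<bar> \<le> K" "AE x in M2. \<bar>x\<bar> \<le> K"
    and mom: "\<And>k. k \<ge> 1 \<Longrightarrow> (\<integral>x. x ^ k \<partial>M1) = (\<integral>x. x ^ k \<partial>M2)"
  shows "M1 = M2"
proof -
  interpret M1: real_distribution M1 by fact
  interpret M2: real_distribution M2 by fact
  have momk: "(\<integral>x. x ^ k \<partial>M1) = (\<integral>x. x ^ k \<partial>M2)" for k
  proof (cases k)
    case 0
    then show ?thesis
      using M1.prob_space M2.prob_space by simp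
  next
    case (Suc k')
    then show ?thesis by (intro mom) simp
  qed
  have int: "integrable N (\<lambda>x. x ^ i)" if "real_distribution N" "AE x in N. \<bar>x\<bar> \<le> K" for N i
    using that by (auto intro!: real_distribution.integrable_bounded_support[where K = K] continuous_intros)
  have momp: "(\<integral>x. poly p x \<partial>M1) = (\<integral>x. poly p x \<partial>M2)" for p
    using int[OF M(1) b(1)] int[OF M(2) b(2)] by (simp add: poly_altdef momk)
  have cs: "(\<integral>x. f x \<partial>M1) = (\<integral>x. f x \<partial>M2)" if "continuous_on UNIV f" for f :: "real \<Rightarrow> real"
    by (rule bounded_support_integral_unique[OF M b momp that])
  have char_N: "char N t = Complex (\<integral>x. cos (t * x) \<partial>N) (\<integral>x. sin (t * x) \<partial>N)"
    if "real_distribution N" for N t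
  proof -
    interpret N: real_distribution N by fact
    have i: "integrable N (\<lambda>x. iexp (t * x))"
      by (rule N.integrable_const_bound[of _ 1]) auto
    have "Re (char N t) = (\<integral>x. Re (iexp (t * x)) \<partial>N)"
      unfolding char_def by (rule integral_Re[OF i, symmetric])
    moreover have "Im (char N t) = (\<integral>x. Im (iexp (t * x)) \<partial>N)"
      unfolding char_def by (rule integral_Im[OF i, symmetric])
    ultimately show ?thesis by (simp add: complex_eq_iff Re_exp Im_exp)
  qed
  have "char M1 t = char M2 t" for t
  proof -
    have "(\<integral>x. cos (t * x) \<partial>M1) = (\<integral>x. cos (t * x) \<partial>M2)"
         "(\<integral>x. sin (t * x) \<partial>M1) = (\<integral>x. sin (t * x) \<partial>M2)"
      by (intro cs continuous_intros)+
    then show ?thesis by (simp only: char_N[OF M(1)] char_N[OF M(2)])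
  qed
  then show ?thesis using Levy_uniqueness[OF M] by auto
qed

text \<open>
  The moment problem is solved on $[0, 1]$ for $b = (K + a)/(2K)$, and its solution is transported
  to $[-K, K]$ by the inverse affine map. The description in \<open>distribution_of\<close> thereby has exactly
  one solution, and the three properties are all that is used of it afterwards.
\<close>

theorem distribution_of_self_adjoint:
  fixes a :: "'a::cstar_algebra"
  assumes st: "state \<phi>" and sa: "self_adjoint a" and K: "norm a < K"
  shows "real_distribution (distribution_of \<phi> a)"
    and "AE x in distribution_of \<phi> a. \<bar>x\<bar> \<le> K"
    and "(\<integral>x. poly p x \<partial>distribution_of \<phi> a) = re_state \<phi> (poly_at p a)"
proof -
  have K0: "K > 0" using K norm_ge_zero[of a] by linarith
  define L where "L p = re_state \<phi> (poly_at (pcompose p [:1/2, 1/(2*K):]) a)" for p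
  have re: "re_state \<phi> x = Re (\<phi> x)" for x by (simp add: re_state_def)
  have L_add: "L (p + q) = L p + L q" for p q
    by (simp add: L_def pcompose_add poly_at_add re_state_add[OF st])
  have L_smult: "L (smult c p) = c * L p" for c p
    by (simp add: L_def pcompose_smult poly_at_smult re_state_scaleR[OF st])
  have L_1: "L 1 = 1" by (simp add: L_def re_state_1[OF st] one_pCons pcompose_pCons)
  have L_pos: "0 \<le> L ([:0, 1:] ^ k * [:1, - 1:] ^ l)" for k l
    using state_power_positive[OF st sa K, of k l]
    by (simp add: L_def pcompose_mult pcompose_power pcompose_pCons re complex_nonneg_Reals_iff)
  obtain M where M: "real_distribution M" "AE x in M. x \<in> {0..1}" "\<And>p. (\<integral>x. poly p x \<partial>M) = L p"
    using hausdorff_moment_problem[of L, OF L_add L_smult L_1 L_pos] by blast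
  interpret M: real_distribution M by fact
  define \<nu> where "\<nu> = distr M borel (\<lambda>x. 2 * K * x - K)"
  have \<nu>: "real_distribution \<nu>"
    unfolding \<nu>_def by (rule M.real_distribution_distr) simp
  interpret \<nu>: real_distribution \<nu> by fact
  have b\<nu>: "AE x in \<nu>. \<bar>x\<bar> \<le> K"
  proof -
    have "AE x in M. \<bar>2 * K * x - K\<bar> \<le> K"
      using M(2) by eventually_elim (use K0 in \<open>auto simp: abs_le_iff\<close>)
    then show ?thesis unfolding \<nu>_def by (subst AE_distr_iff) auto
  qed
  have int\<nu>: "(\<integral>x. poly p x \<partial>\<nu>) = re_state \<phi> (poly_at p a)" for p
  proof -
    have "(\<integral>x. poly p x \<partial>\<nu>) = (\<integral>x. poly p (2 * K * x - K) \<partial>M)"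
      unfolding \<nu>_def
      by (rule integral_distr) (auto intro!: borel_measurable_continuous_onI continuous_intros)
    also have "\<dots> = (\<integral>x. poly (pcompose p [:-K, 2*K:]) x \<partial>M)"
      by (simp add: poly_pcompose algebra_simps)
    also have "\<dots> = re_state \<phi> (poly_at (pcompose (pcompose p [:-K, 2*K:]) [:1/2, 1/(2*K):]) a)"
      by (simp add: M(3) L_def)
    also have "pcompose (pcompose p [:-K, 2*K:]) [:1/2, 1/(2*K):] = p"
      using K0 by (simp add: pcompose_assoc[symmetric] pcompose_pCons)
    finally show ?thesis .
  qed
  have pow: "poly ([:0, 1:] ^ k) x = x ^ k" "poly_at ([:0, 1:] ^ k) a = a ^ k" for k and x :: real
    by (simp_all add: poly_at_power)
  have mom\<nu>: "complex_of_real (\<integral>x. x ^ k \<partial>\<nu>) = \<phi> (a ^ k)" for k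
    using int\<nu>[of "[:0, 1:] ^ k"] state_self_adjoint[OF st, of "a ^ k"] sa
    by (simp add: pow self_adjoint_def star_power)
  have "distribution_of \<phi> a = \<nu>"
    unfolding distribution_of_def
  proof (rule the_equality, intro conjI allI impI exI)
    show "real_distribution \<nu>" by fact
    show "compact {-K..K}" by simp
    have "AE x in \<nu>. x \<notin> - {-K..K}" using b\<nu> by eventually_elim (auto simp: abs_le_iff)
    then show "emeasure \<nu> (- {-K..K}) = 0"
      by (subst (asm) AE_iff_measurable[OF _ refl]) (auto simp: Compl_eq)
    show "complex_of_real (\<integral>x. x ^ k \<partial>\<nu>) = \<phi> (a ^ k)" for k by (rule mom\<nu>)
  next
    fix \<mu> assume "real_distribution \<mu> \<and> (\<exists>C. compact C \<and> emeasure \<mu> (- C) = 0) \<and>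
      (\<forall>k\<ge>1. complex_of_real (\<integral>x. x ^ k \<partial>\<mu>) = \<phi> (a ^ k))"
    then obtain C where \<mu>: "real_distribution \<mu>" "compact C" "emeasure \<mu> (- C) = 0"
      "\<And>k. k \<ge> 1 \<Longrightarrow> complex_of_real (\<integral>x. x ^ k \<partial>\<mu>) = \<phi> (a ^ k)" by blast
    interpret \<mu>: real_distribution \<mu> by fact
    obtain B where B: "\<And>x. x \<in> C \<Longrightarrow> \<bar>x\<bar> \<le> B"
      using compact_imp_bounded[OF \<mu>(2)] unfolding bounded_iff by auto
    have "AE x in \<mu>. x \<notin> - C"
      using \<mu>(3) compact_imp_closed[OF \<mu>(2)] by (intro AE_not_in null_setsI) auto
    then have b1: "AE x in \<mu>. \<bar>x\<bar> \<le> max B K"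
      by eventually_elim (use B in force)
    have b2: "AE x in \<nu>. \<bar>x\<bar> \<le> max B K" using b\<nu> by eventually_elim simp
    show "\<mu> = \<nu>"
    proof (rule bounded_support_moments_unique[OF \<mu>(1) \<nu> b1 b2])
      show "(\<integral>x. x ^ k \<partial>\<mu>) = (\<integral>x. x ^ k \<partial>\<nu>)" if "k \<ge> 1" for k
        using \<mu>(4)[OF that] mom\<nu>[of k] by (metis of_real_eq_iff)
    qed
  qed
  with \<nu> b\<nu> int\<nu> show "real_distribution (distribution_of \<phi> a)"
     "AE x in distribution_of \<phi> a. \<bar>x\<bar> \<le> K"
     "(\<integral>x. poly p x \<partial>distribution_of \<phi> a) = re_state \<phi> (poly_at p a)" by auto
qed

section \<open>Boolean independence and null vectors\<close>

lemma module_scaleC: "module (scaleC :: complex \<Rightarrow> 'a::cstar_algebra \<Rightarrow> 'a)"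
  by unfold_locales
     (auto simp: scaleC_add_right scaleC_add_left scaleC_scaleC scaleC_one)

lemma poly_at_in_Alg:
  assumes "coeff p 0 = 0"
  shows "poly_at p a \<in> Alg (a::'a::cstar_algebra)"
  unfolding poly_at_def Alg_def
proof (rule module.span_sum[OF module_scaleC])
  fix i
  show "coeff p i *\<^sub>R a ^ i \<in> module.span scaleC {a ^ k |k. 1 \<le> k}"
  proof (cases "i = 0")
    case True
    then show ?thesis using assms by (simp add: module.span_zero[OF module_scaleC])
  next
    case False
    then have "a ^ i \<in> {a ^ k |k. 1 \<le> k}" by (auto intro!: exI[of _ i])
    then show ?thesis
      unfolding scaleR_scaleC
      by (intro module.span_scale[OF module_scaleC] module.span_base[OF module_scaleC])
  qed
qed

lemma scaleC_in_Alg: "x \<in> Alg a \<Longrightarrow> scaleC c x \<in> Alg a"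
  unfolding Alg_def by (rule module.span_scale[OF module_scaleC])

text \<open>
  The product rule extends to factors equal to the unit: such a factor is replaced by twice the
  unit, which the definition admits, and linearity cancels the factor $2$ from both sides.
\<close>

lemma boolean_independent_prod:
  assumes st: "state \<phi>" and bi: "boolean_independent \<phi> I A"
    and A: "\<And>i c x. i \<in> I \<Longrightarrow> x \<in> A i \<Longrightarrow> scaleC c x \<in> A i"
    and n: "n \<ge> 1" and x: "\<And>j. j \<in> {1..n} \<Longrightarrow> i j \<in> I \<and> x j \<in> A (i j)"
    and alt: "\<And>j. 1 \<le> j \<Longrightarrow> j \<le> n - 1 \<Longrightarrow> i j \<noteq> i (j + 1)"
  shows "\<phi> (\<Prod>j\<leftarrow>[1..<n+1]. x j) = (\<Prod>j=1..n. \<phi> (x j))"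
proof -
  define c where "c j = (if x j = 1 then 2 else 1 :: complex)" for j
  define y where "y j = scaleC (c j) (x j)" for j
  have "scaleC 2 (1::'a) \<noteq> 1" using norm_scaleC[of 2 "1::'a"] by auto
  then have y1: "y j \<noteq> 1" for j by (auto simp: y_def c_def scaleC_one)
  have "(\<forall>j\<in>{1..n}. i j \<in> I \<and> y j \<in> A (i j) \<and> y j \<noteq> 1) \<and>
      (\<forall>j. 1 \<le> j \<and> j \<le> n - 1 \<longrightarrow> i j \<noteq> i (j + 1))"
    using x alt A y1 by (auto simp: y_def)
  with bi n have "\<phi> (\<Prod>j\<leftarrow>[1..<n+1]. y j) = (\<Prod>j=1..n. \<phi> (y j))"
    unfolding boolean_independent_def by blast
  moreover have "(\<Prod>j\<leftarrow>[1..<m+1]. y j) = scaleC (\<Prod>j=1..m. c j) (\<Prod>j\<leftarrow>[1..<m+1]. x j)" for m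
  proof (induction m)
    case 0
    show ?case by (simp add: scaleC_one)
  next
    case (Suc m)
    have upt: "[1..<Suc m + 1] = [1..<m + 1] @ [Suc m]" by simp
    have "{1..Suc m} = insert (Suc m) {1..m}" by auto
    then have "(\<Prod>j=1..Suc m. c j) = c (Suc m) * (\<Prod>j=1..m. c j)" by simp
    then show ?case
      unfolding upt map_append prod_list.append Suc.IH
      by (simp only: list.map prod_list.Cons prod_list.Nil mult_1_right y_def mult_scaleC_left
          mult_scaleC_right scaleC_scaleC)
  qed
  ultimately have "(\<Prod>j=1..n. c j) * \<phi> (\<Prod>j\<leftarrow>[1..<n+1]. x j) = (\<Prod>j=1..n. c j) * (\<Prod>j=1..n. \<phi> (x j))"
    by (simp only: y_def state_scaleC[OF st] prod.distrib)
  moreover have "(\<Prod>j=1..n. c j) \<noteq> 0" by (simp add: c_def)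
  ultimately show ?thesis by simp
qed

text \<open>
  These are the elements that represent the zero vector of the GNS space. Working modulo this left
  ideal replaces the construction of that space.
\<close>

definition state_null :: "('a::cstar_algebra \<Rightarrow> complex) \<Rightarrow> 'a \<Rightarrow> bool" where
  "state_null \<phi> x \<longleftrightarrow> re_state \<phi> (star x * x) = 0"

context
  fixes \<phi> :: "'a::cstar_algebra \<Rightarrow> complex"
  assumes st: "state \<phi>"
begin

lemma state_null_right:
  assumes "state_null \<phi> z"
  shows "re_state \<phi> (y * z) = 0"
  using re_state_cauchy_schwarz[OF st, of "star y" z] assms
  by (simp add: state_null_def star_star)

lemma state_null_mult:
  assumes "state_null \<phi> z"
  shows "state_null \<phi> (y * z)"
  unfolding state_null_def
  using state_null_right[OF assms, of "star (y * z) * y"] by (simp add: mult.assoc)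

lemma state_null_left:
  assumes "state_null \<phi> z"
  shows "re_state \<phi> (star z * y) = 0"
  using re_state_star[OF st, of "star z * y"] state_null_right[OF assms, of "star y"]
  by (simp add: star_mult star_star)

lemma state_null_add:
  assumes "state_null \<phi> x" "state_null \<phi> y"
  shows "state_null \<phi> (x + y)"
proof -
  have "star (x + y) * (x + y) = star x * (x + y) + star y * (x + y)"
    by (simp add: star_add algebra_simps)
  then show ?thesis
    using assms[THEN state_null_left] by (simp add: state_null_def re_state_add[OF st])
qed

lemma state_null_scaleR: "state_null \<phi> x \<Longrightarrow> state_null \<phi> (r *\<^sub>R x)"
  by (simp add: state_null_def star_scaleR re_state_scaleR[OF st])

lemma state_null_0 [simp]: "state_null \<phi> 0"
  by (simp add: state_null_def re_state_0[OF st])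

lemma state_null_sum: "(\<And>i. i \<in> A \<Longrightarrow> state_null \<phi> (f i)) \<Longrightarrow> state_null \<phi> (\<Sum>i\<in>A. f i)"
  by (induction A rule: infinite_finite_induct) (auto intro: state_null_add)

text \<open>
  The quantities that the variational argument needs depend on the GNS vector only.
\<close>

lemma state_null_diff_cong:
  assumes "state_null \<phi> (x - y)"
  shows "re_state \<phi> x = re_state \<phi> y"
    and "re_state \<phi> (star x * x) = re_state \<phi> (star y * y)"
proof -
  show "re_state \<phi> x = re_state \<phi> y"
    using state_null_right[OF assms, of 1] by (simp add: re_state_diff[OF st])
  define z where "z = x - y"
  have x: "x = y + z" by (simp add: z_def)
  have z: "state_null \<phi> z" using assms by (simp add: z_def)
  have "star (y + z) * (y + z) = star y * y + star y * z + star z * (y + z)"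
    by (simp add: star_add algebra_simps)
  then show "re_state \<phi> (star x * x) = re_state \<phi> (star y * y)"
    using state_null_left[OF z] state_null_right[OF z] by (simp add: x re_state_add[OF st])
qed

end

lemma sum_diagonal_offdiagonal:
  fixes A B :: real
  shows "(\<Sum>i=1..n. \<Sum>j=1..n. if i = j then A else B) = real n * A + real n * (real n - 1) * B"
proof -
  have "(\<Sum>j=1..n. if i = j then A else B) = A + (real n - 1) * B" if "i \<in> {1..n}" for i
  proof -
    have "(\<Sum>j=1..n. if i = j then A else B) = (\<Sum>j=1..n. (if i = j then A - B else 0) + B)"
      by (intro sum.cong) auto
    also have "\<dots> = A + (real n - 1) * B"
      using that by (simp add: sum.distrib algebra_simps)
    finally show ?thesis .
  qed
  then have "(\<Sum>i=1..n. \<Sum>j=1..n. if i = j then A else B) = (\<Sum>i=1..n. A + (real n - 1) * B)"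
    by (rule sum.cong[OF refl])
  then show ?thesis by (simp add: algebra_simps)
qed

section \<open>Vectors generated by a sum of Boolean independent variables\<close>

text \<open>
  The quadratic form of $T^2 + y^2$ for self-adjoint $T$, written so that its nonnegativity is
  visible.
\<close>

definition resolvent_energy :: "('a::cstar_algebra \<Rightarrow> complex) \<Rightarrow> 'a \<Rightarrow> real \<Rightarrow> 'a \<Rightarrow> real" where
  "resolvent_energy \<phi> T y \<xi> =
     re_state \<phi> (star (T * \<xi>) * (T * \<xi>)) + y\<^sup>2 * re_state \<phi> (star \<xi> * \<xi>)"

locale boolean_iid =
  fixes \<phi> :: "'a::cstar_algebra \<Rightarrow> complex" and a :: "nat \<Rightarrow> 'a"
  assumes st: "state \<phi>"
    and sa: "\<And>i. i \<ge> 1 \<Longrightarrow> self_adjoint (a i)"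
    and iden: "identically_distributed \<phi> {1..} a"
    and bool: "boolean_independent \<phi> {1..} (\<lambda>i. Alg (a i))"
begin

definition law :: "real poly \<Rightarrow> real" where
  "law p = re_state \<phi> (poly_at p (a 1))"

text \<open>
  The sums $c + u(a_1) + \dots + u(a_n)$ with $u$ centered represent the vectors on which the
  normalized sums act; they are invariant under permutations of the variables.
\<close>

definition copies_sum :: "nat \<Rightarrow> real poly \<Rightarrow> 'a" where
  "copies_sum n u = (\<Sum>i=1..n. poly_at u (a i))"

definition symmetric_vec :: "nat \<Rightarrow> real \<Rightarrow> real poly \<Rightarrow> 'a" where
  "symmetric_vec n c u = c *\<^sub>R 1 + copies_sum n u"

definition clt_sum :: "nat \<Rightarrow> 'a" where
  "clt_sum n = (1 / sqrt (real n)) *\<^sub>R (\<Sum>i=1..n. a i)"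

text \<open>
  The energy of the vector $1 + \sum_i u(a_i)$ at the normalized sum of $n$ variables, in terms of
  $h = 1 + u$ and a single variable.
\<close>

definition reduced_energy :: "nat \<Rightarrow> real \<Rightarrow> real poly \<Rightarrow> real" where
  "reduced_energy n y h = law (([:0, 1:] * h)\<^sup>2) + (real n - 1) * (law ([:0, 1:] * h))\<^sup>2
             + y\<^sup>2 * (real n * law (h\<^sup>2) - (real n - 1))"

lemma law_add: "law (p + q) = law p + law q"
  and law_diff: "law (p - q) = law p - law q"
  and law_smult: "law (smult c p) = c * law p"
  and law_const: "law [:c:] = c"
  by (auto simp: law_def poly_at_add poly_at_diff poly_at_smult re_state_add[OF st] re_state_diff[OF st] re_state_scaleR[OF st] re_state_1[OF st])

lemma law_square: "law (p\<^sup>2) \<ge> 0"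
  using re_state_pos[OF st, of "poly_at p (a 1)"] star_poly_at[OF sa, of 1 p]
  by (simp add: law_def power2_eq_square poly_at_mult)

lemma re_state_poly_at: "i \<ge> 1 \<Longrightarrow> re_state \<phi> (poly_at p (a i)) = law p"
proof -
  assume i: "i \<ge> 1"
  have "re_state \<phi> (a i ^ k) = re_state \<phi> (a 1 ^ k)" for k
  proof (cases "k = 0")
    case False
    then have "i \<in> {1..}" "1 \<in> {1::nat..}" "k \<ge> 1" using i by auto
    then have "\<phi> (a i ^ k) = \<phi> (a 1 ^ k)"
      using iden unfolding identically_distributed_def by blast
    then show ?thesis by (simp only: re_state_def)
  qed simp
  then show ?thesis by (simp add: law_def poly_at_def re_state_sum[OF st] re_state_scaleR[OF st])
qed

lemma state_poly_at: "i \<ge> 1 \<Longrightarrow> \<phi> (poly_at p (a i)) = of_real (law p)"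
  using state_self_adjoint[OF st, of "poly_at p (a i)"] star_poly_at[OF sa, of i p]
  by (simp add: re_state_poly_at)

lemma boolean_pair_aux:
  assumes "i \<ge> 1" "j \<ge> 1" "i \<noteq> j" "coeff p 0 = 0" "coeff q 0 = 0"
  shows "re_state \<phi> (poly_at p (a i) * poly_at q (a j)) = law p * law q"
proof -
  define x where "x k = (if k = Suc 0 then poly_at p (a i) else poly_at q (a j))" for k
  have "\<phi> (\<Prod>k\<leftarrow>[1..<2+1]. x k) = (\<Prod>k=1..2. \<phi> (x k))"
    by (rule boolean_independent_prod[OF st bool, where i = "\<lambda>k. if k = Suc 0 then i else j"])
       (use assms in \<open>auto simp: x_def poly_at_in_Alg scaleC_in_Alg numeral_eq_Suc le_Suc_eq\<close>)
  then have "\<phi> (poly_at p (a i) * poly_at q (a j)) = of_real (law p) * of_real (law q)"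
    using assms by (simp add: x_def upt_rec numeral_2_eq_2 state_poly_at)
  then show ?thesis by (simp add: re_state_def)
qed

lemma boolean_triple_aux:
  assumes "i \<ge> 1" "j \<ge> 1" "i \<noteq> j" "coeff p 0 = 0" "coeff q 0 = 0" "coeff r 0 = 0"
  shows "re_state \<phi> (poly_at p (a i) * poly_at q (a j) * poly_at r (a i)) = law p * law q * law r"
proof -
  define x where "x k = (if k = Suc 0 then poly_at p (a i)
     else if k = Suc (Suc 0) then poly_at q (a j) else poly_at r (a i))" for k
  have "\<phi> (\<Prod>k\<leftarrow>[1..<3+1]. x k) = (\<Prod>k=1..3. \<phi> (x k))"
    by (rule boolean_independent_prod[OF st bool, where i = "\<lambda>k. if k = Suc (Suc 0) then j else i"])
       (use assms in \<open>auto simp: x_def poly_at_in_Alg scaleC_in_Alg numeral_eq_Suc le_Suc_eq\<close>)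
  then have "\<phi> (poly_at p (a i) * (poly_at q (a j) * poly_at r (a i)))
      = of_real (law p) * of_real (law q) * of_real (law r)"
    using assms by (simp add: x_def upt_rec numeral_3_eq_3 numeral_2_eq_2 state_poly_at)
  then show ?thesis by (simp add: re_state_def mult.assoc)
qed

text \<open>
  Boolean independence concerns polynomials without constant term, since the algebras need not
  contain the unit. Splitting off the constant terms extends it to the forms needed below.
\<close>

lemma split_const:
  fixes p :: "real poly"
  obtains p' where "p = [:coeff p 0:] + p'" "coeff p' 0 = 0"
  by (rule that[of "p - [:coeff p 0:]"]) auto

lemma boolean_pair:
  assumes ij: "i \<ge> 1" "j \<ge> 1" "i \<noteq> j"
  shows "re_state \<phi> (poly_at p (a i) * poly_at q (a j)) = law p * law q"
proof -
  obtain p' where p: "p = [:coeff p 0:] + p'" "coeff p' 0 = 0" by (rule split_const)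
  obtain q' where q: "q = [:coeff q 0:] + q'" "coeff q' 0 = 0" by (rule split_const)
  have "re_state \<phi> (poly_at ([:c:] + p') (a i) * poly_at ([:d:] + q') (a j))
      = law ([:c:] + p') * law ([:d:] + q')" for c d
    using boolean_pair_aux[OF ij p(2) q(2)] ij
    by (simp add: poly_at_add algebra_simps re_state_add[OF st] re_state_scaleR[OF st] re_state_poly_at law_add law_const
        re_state_1[OF st])
  then show ?thesis using p(1) q(1) by metis
qed

text \<open>
  Expanding both outer factors as constant plus nonconstant part, the four products have the
  values $c^2$, twice $c \Lambda(p')$, and $\Lambda(p')^2$ times $\Lambda(q)$. The middle factor
  must have no constant term, as $q = 1$ shows.
\<close>

lemma boolean_sandwich:
  assumes ij: "i \<ge> 1" "j \<ge> 1" "i \<noteq> j" and q: "coeff q 0 = 0"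
  shows "re_state \<phi> (poly_at p (a i) * poly_at q (a j) * poly_at p (a i)) = law q * (law p)\<^sup>2"
proof -
  obtain p' where p: "p = [:coeff p 0:] + p'" "coeff p' 0 = 0" by (rule split_const)
  have "re_state \<phi> (poly_at ([:c:] + p') (a i) * poly_at q (a j) * poly_at ([:c:] + p') (a i))
      = law q * (law ([:c:] + p'))\<^sup>2" for c
    using boolean_triple_aux[OF ij p(2) q p(2)] boolean_pair_aux[OF ij p(2) q]
      boolean_pair_aux[OF ij(2,1) ij(3)[symmetric] q p(2)] ij
    by (simp add: poly_at_add algebra_simps re_state_add[OF st] re_state_scaleR[OF st] re_state_poly_at law_add law_const
        power2_eq_square)
  then show ?thesis using p(1) by metis
qed

text \<open>
  The feature of Boolean independence that drives the proof: outside the vacuum direction, an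
  algebra acts by zero on the vectors created by the other algebras.
\<close>

lemma centered_annihilated:
  assumes ij: "i \<ge> 1" "j \<ge> 1" "i \<noteq> j" and u: "law u = 0"
  shows "state_null \<phi> (a j * poly_at u (a i))"
proof -
  have "star (a j * poly_at u (a i)) * (a j * poly_at u (a i))
      = poly_at u (a i) * poly_at ([:0, 1:]\<^sup>2) (a j) * poly_at u (a i)"
  proof -
    have "poly_at ([:0, 1:]\<^sup>2) (a j) = a j * a j"
      by (simp only: power2_eq_square poly_at_mult poly_at_X)
    then show ?thesis
      using sa[of j] star_poly_at[OF sa, of i u] ij
      by (simp add: star_mult self_adjoint_def mult.assoc)
  qed
  moreover have "coeff ([:0, 1:]\<^sup>2 :: real poly) 0 = 0" by (simp add: power2_eq_square)
  ultimately show ?thesis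
    using boolean_sandwich[OF ij, of "[:0, 1:]\<^sup>2" u] u by (simp add: state_null_def)
qed

lemma star_copies_sum: "star (copies_sum n u) = copies_sum n u"
  unfolding copies_sum_def linear_sum[OF linear_star] by (intro sum.cong star_poly_at sa) auto

lemma star_symmetric_vec: "star (symmetric_vec n c u) = symmetric_vec n c u"
  by (simp add: symmetric_vec_def star_add star_scaleR star_copies_sum)

lemma re_state_copies_sum: "re_state \<phi> (copies_sum n u) = real n * law u"
  by (simp add: copies_sum_def re_state_sum[OF st] re_state_poly_at)

lemma re_state_symmetric_vec: "law u = 0 \<Longrightarrow> re_state \<phi> (symmetric_vec n c u) = c"
  by (simp add: symmetric_vec_def re_state_add[OF st] re_state_scaleR[OF st] re_state_copies_sum re_state_1[OF st])

lemma re_state_copies_sum_square: "re_state \<phi> (copies_sum n u * copies_sum n u) = real n * law (u\<^sup>2) + real n * (real n - 1) * (law u)\<^sup>2"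
proof -
  have "re_state \<phi> (copies_sum n u * copies_sum n u)
      = (\<Sum>i=1..n. \<Sum>j=1..n. re_state \<phi> (poly_at u (a i) * poly_at u (a j)))"
    by (simp add: copies_sum_def sum_product re_state_sum[OF st])
  also have "\<dots> = (\<Sum>i=1..n. \<Sum>j=1..n. if i = j then law (u\<^sup>2) else (law u)\<^sup>2)"
    by (intro sum.cong refl)
       (auto simp: boolean_pair power2_eq_square poly_at_mult[symmetric] re_state_poly_at)
  finally show ?thesis by (simp only: sum_diagonal_offdiagonal)
qed

lemma re_state_symmetric_vec_square: "law u = 0 \<Longrightarrow> re_state \<phi> (symmetric_vec n c u * symmetric_vec n c u) = c\<^sup>2 + real n * law (u\<^sup>2)"
  by (simp add: symmetric_vec_def algebra_simps re_state_add[OF st] re_state_scaleR[OF st] re_state_copies_sum re_state_copies_sum_square re_state_1[OF st]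
      power2_eq_square)

text \<open>
  In the product of the two sums all cross terms $a_j u(a_i)$ are null, and only the diagonal
  survives.
\<close>

lemma clt_sum_action:
  assumes u: "law u = 0"
  shows "state_null \<phi> (clt_sum n * symmetric_vec n c u - (1 / sqrt (real n)) *\<^sub>R copies_sum n ([:0, 1:] * ([:c:] + u)))"
proof -
  have g: "poly_at ([:0, 1:] * ([:c:] + u)) x = c *\<^sub>R x + x * poly_at u x" for x :: 'a
    by (simp only: poly_at_mult poly_at_X poly_at_add poly_at_const) (simp add: algebra_simps)
  have "(\<Sum>j=1..n. a j) * symmetric_vec n c u
     = (\<Sum>j=1..n. c *\<^sub>R a j + (\<Sum>i=1..n. a j * poly_at u (a i)))"
    by (simp add: symmetric_vec_def copies_sum_def distrib_left sum_distrib_right sum_distrib_left sum.distrib scaleR_sum_right)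
       (rule sum.swap)
  also have "\<dots> = (\<Sum>j=1..n. poly_at ([:0, 1:] * ([:c:] + u)) (a j)
                       + (\<Sum>i\<in>{1..n} - {j}. a j * poly_at u (a i)))"
    unfolding g
    by (intro sum.cong refl)
       (simp add: sum.remove[of _ _ "\<lambda>i. _ * poly_at u (a i)"] algebra_simps)
  finally have eq: "clt_sum n * symmetric_vec n c u - (1 / sqrt (real n)) *\<^sub>R copies_sum n ([:0, 1:] * ([:c:] + u))
     = (1 / sqrt (real n)) *\<^sub>R (\<Sum>j=1..n. \<Sum>i\<in>{1..n} - {j}. a j * poly_at u (a i))"
    by (simp add: clt_sum_def copies_sum_def sum.distrib scaleR_add_right)
  show ?thesis
    unfolding eq using u
    by (intro state_null_scaleR[OF st] state_null_sum[OF st] centered_annihilated) auto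
qed

text \<open>
  Centering the summands collects $n \Lambda(g)/\sqrt n = \sqrt n\,\Lambda(g)$ in the constant term.
\<close>

lemma scaled_copies_sum:
  assumes "n \<ge> 1"
  shows "(1 / sqrt (real n)) *\<^sub>R copies_sum n g
     = symmetric_vec n (sqrt (real n) * law g) (smult (1 / sqrt (real n)) (g - [:law g:]))"
proof -
  have "copies_sum n (smult (1 / sqrt (real n)) (g - [:law g:]))
     = (1 / sqrt (real n)) *\<^sub>R copies_sum n g - ((1 / sqrt (real n)) * real n * law g) *\<^sub>R 1"
  proof -
    have "(\<Sum>i=1..n. (1::'a)) = real n *\<^sub>R 1"
      by (simp add: scaleR_conv_of_real)
    then show ?thesis
      by (simp add: copies_sum_def poly_at_smult poly_at_diff scaleR_sum_right[symmetric] sum_subtractf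
          scaleR_diff_right mult.commute del: sum_constant)
  qed
  moreover have "real n * law g / sqrt (real n) = sqrt (real n) * law g"
  proof -
    have "real n * law g / sqrt (real n) = real n / sqrt (real n) * law g" by simp
    also have "real n / sqrt (real n) = sqrt (real n)" by (rule real_div_sqrt) simp
    finally show ?thesis .
  qed
  ultimately show ?thesis by (simp add: symmetric_vec_def)
qed

text \<open>
  Horner's scheme: multiplication by the normalized sum preserves the form of a symmetric vector,
  by the two preceding lemmas.
\<close>

lemma poly_clt_sum_symmetric:
  assumes n: "n \<ge> 1"
  shows "\<exists>c u. law u = 0 \<and> state_null \<phi> (poly_at q (clt_sum n) - symmetric_vec n c u)"
proof (induction q)
  case 0
  show ?case
    by (intro exI[of _ 0]) (simp add: symmetric_vec_def copies_sum_def law_const[of 0, simplified] state_null_0[OF st])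
next
  case (pCons \<alpha> q)
  then obtain c u where u: "law u = 0" and N: "state_null \<phi> (poly_at q (clt_sum n) - symmetric_vec n c u)" by blast
  define g where "g = [:0, 1:] * ([:c:] + u)"
  define u' where "u' = smult (1 / sqrt (real n)) (g - [:law g:])"
  have "law u' = 0" by (simp add: u'_def law_smult law_diff law_const)
  moreover have "poly_at (pCons \<alpha> q) (clt_sum n) - symmetric_vec n (\<alpha> + sqrt (real n) * law g) u'
     = clt_sum n * (poly_at q (clt_sum n) - symmetric_vec n c u) + (clt_sum n * symmetric_vec n c u - (1 / sqrt (real n)) *\<^sub>R copies_sum n g)"
    unfolding scaled_copies_sum[OF n] u'_def[symmetric]
    by (simp add: symmetric_vec_def poly_at_pCons algebra_simps)
  ultimately show ?case
    using state_null_add[OF st state_null_mult[OF st N, of "clt_sum n"] clt_sum_action[OF u, of n c, folded g_def]]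
    by metis
qed

lemma resolvent_energy_cong:
  assumes "state_null \<phi> (x - z)"
  shows "resolvent_energy \<phi> S y x = resolvent_energy \<phi> S y z"
  using state_null_diff_cong(2)[OF st assms] state_null_diff_cong(2)[OF st, of "S * x" "S * z"]
    state_null_mult[OF st assms, of S]
  by (simp add: resolvent_energy_def right_diff_distrib)

lemma resolvent_energy_symmetric_vec:
  assumes n: "n \<ge> 1" and u: "law u = 0"
  shows "resolvent_energy \<phi> (clt_sum n) y (symmetric_vec n 1 u) = reduced_energy n y ([:1:] + u)"
proof -
  define g where "g = [:0, 1:] * ([:1:] + u)"
  have "re_state \<phi> (star (clt_sum n * symmetric_vec n 1 u) * (clt_sum n * symmetric_vec n 1 u))
     = re_state \<phi> (star ((1 / sqrt (real n)) *\<^sub>R copies_sum n g) * ((1 / sqrt (real n)) *\<^sub>R copies_sum n g))"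
    unfolding g_def by (rule state_null_diff_cong(2)[OF st clt_sum_action[OF u]])
  also have "\<dots> = (1 / real n) * re_state \<phi> (copies_sum n g * copies_sum n g)"
    by (simp add: star_scaleR star_copies_sum re_state_scaleR[OF st])
  also have "\<dots> = law (g\<^sup>2) + (real n - 1) * (law g)\<^sup>2"
    using n by (simp add: re_state_copies_sum_square field_simps)
  finally have 1: "re_state \<phi> (star (clt_sum n * symmetric_vec n 1 u) * (clt_sum n * symmetric_vec n 1 u)) = law (g\<^sup>2) + (real n - 1) * (law g)\<^sup>2" .
  have "([:1:] + u)\<^sup>2 = [:1:] + smult 2 u + u\<^sup>2"
    by (simp add: power2_eq_square algebra_simps smult_add_left[of 1 1 u, simplified] one_pCons[symmetric])
  then have "law (([:1:] + u)\<^sup>2) = 1 + law (u\<^sup>2)" using u by (simp add: law_add law_smult law_const)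
  then show ?thesis
    unfolding resolvent_energy_def reduced_energy_def 1 star_symmetric_vec re_state_symmetric_vec_square[OF u] g_def[symmetric]
    by (simp add: algebra_simps)
qed

text \<open>
  The same centered $u$ is used for both numbers of variables. A polynomial in the sum of $m$
  variables determines $u$, and the symmetric vector with this $u$ in $n$ variables is the competitor;
  it need not be a polynomial in the sum of $n$ variables, which is why the lower bound in the
  variational formula is needed for arbitrary elements.
\<close>

lemma resolvent_energy_decreases:
  assumes n: "1 \<le> n" "n \<le> m" and q: "re_state \<phi> (poly_at q (clt_sum m)) = 1"
  shows "\<exists>\<xi>. re_state \<phi> \<xi> = 1 \<and>
           resolvent_energy \<phi> (clt_sum n) y \<xi> \<le> resolvent_energy \<phi> (clt_sum m) y (poly_at q (clt_sum m))"
proof -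
  obtain c u where u: "law u = 0" and N: "state_null \<phi> (poly_at q (clt_sum m) - symmetric_vec m c u)"
    using poly_clt_sum_symmetric[of m q] n by auto
  have c: "c = 1"
    using state_null_diff_cong(1)[OF st N] q re_state_symmetric_vec[OF u] by simp
  define h where "h = [:1:] + u"
  have "resolvent_energy \<phi> (clt_sum m) y (poly_at q (clt_sum m)) = reduced_energy m y h"
    using resolvent_energy_cong[OF N] resolvent_energy_symmetric_vec[OF _ u, of m y] n by (simp add: c h_def)
  moreover have "resolvent_energy \<phi> (clt_sum n) y (symmetric_vec n 1 u) = reduced_energy n y h"
    using resolvent_energy_symmetric_vec[OF n(1) u] by (simp add: h_def)
  moreover have "reduced_energy n y h \<le> reduced_energy m y h"
  proof -
    have h1: "law (h\<^sup>2) \<ge> 1"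
    proof -
      have "h\<^sup>2 = [:1:] + smult 2 u + u\<^sup>2"
        by (simp add: h_def power2_eq_square algebra_simps smult_add_left[of 1 1 u, simplified] one_pCons[symmetric])
      then show ?thesis using u law_square[of u] by (simp add: law_add law_smult law_const)
    qed
    have "reduced_energy m y h - reduced_energy n y h
       = (real m - real n) * ((law ([:0, 1:] * h))\<^sup>2 + y\<^sup>2 * (law (h\<^sup>2) - 1))"
      by (simp add: reduced_energy_def algebra_simps)
    also have "\<dots> \<ge> 0" using n h1 by (intro mult_nonneg_nonneg add_nonneg_nonneg) auto
    finally show ?thesis by simp
  qed
  ultimately show ?thesis
    using re_state_symmetric_vec[OF u] by metis
qed

end

section \<open>The variational formula for the resolvent\<close>

text \<open>
  Up to the factor $-y$ this is the imaginary part of the Cauchy transform of $\mu$ at $i y$.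
\<close>

definition resolvent_mass :: "real measure \<Rightarrow> real \<Rightarrow> real" where
  "resolvent_mass \<mu> y = (\<integral>x. 1 / (x\<^sup>2 + y\<^sup>2) \<partial>\<mu>)"

lemma (in real_distribution) integral_tendsto_bounded_support:
  fixes f :: "nat \<Rightarrow> real \<Rightarrow> real"
  assumes K: "AE x in M. \<bar>x\<bar> \<le> K"
    and lim: "\<And>x. \<bar>x\<bar> \<le> K \<Longrightarrow> (\<lambda>k. f k x) \<longlonglongrightarrow> g x"
    and bd: "\<And>k x. \<bar>x\<bar> \<le> K \<Longrightarrow> \<bar>f k x\<bar> \<le> B"
    and meas: "\<And>k. f k \<in> borel_measurable borel" "g \<in> borel_measurable borel"
  shows "(\<lambda>k. \<integral>x. f k x \<partial>M) \<longlonglongrightarrow> (\<integral>x. g x \<partial>M)"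
proof (rule integral_dominated_convergence[where w = "\<lambda>_. B"])
  show "AE x in M. (\<lambda>k. f k x) \<longlonglongrightarrow> g x" using K by eventually_elim (rule lim)
  show "AE x in M. norm (f k x) \<le> B" for k using K by eventually_elim (simp add: bd)
qed (use meas in auto)

lemma sum_cauchy_schwarz:
  fixes p1 p2 :: real
  assumes "p1\<^sup>2 \<le> a1 * b1" "p2\<^sup>2 \<le> a2 * b2" "a1 \<ge> 0" "a2 \<ge> 0" "b1 \<ge> 0" "b2 \<ge> 0"
  shows "(p1 + p2)\<^sup>2 \<le> (a1 + a2) * (b1 + b2)"
proof -
  have "(2 * p1 * p2)\<^sup>2 = 4 * (p1\<^sup>2 * p2\<^sup>2)" by (simp add: power2_eq_square)
  also have "\<dots> \<le> 4 * ((a1 * b1) * (a2 * b2))" using assms by (intro mult_left_mono mult_mono) auto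
  also have "\<dots> \<le> (a1 * b2 + a2 * b1)\<^sup>2"
    using zero_le_power2[of "a1 * b2 - a2 * b1"] by (simp add: power2_eq_square algebra_simps)
  finally have "\<bar>2 * p1 * p2\<bar> \<le> \<bar>a1 * b2 + a2 * b1\<bar>" by (simp only: abs_le_square_iff)
  then have "2 * p1 * p2 \<le> a1 * b2 + a2 * b1" using assms by (simp add: abs_le_iff)
  then show ?thesis using assms by (simp add: power2_eq_square algebra_simps)
qed

definition square_plus :: "real \<Rightarrow> real poly" where
  "square_plus y = [:y\<^sup>2, 0, 1:]"

context
  fixes \<phi> :: "'a::cstar_algebra \<Rightarrow> complex" and T :: 'a and y :: real
  assumes st: "state \<phi>" and sa: "self_adjoint T" and y: "y > 0"
begin

lemmas dist_T = distribution_of_self_adjoint[OF st sa, of "norm T + 1", simplified]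

lemma poly_at_square_plus: "poly_at (square_plus y) T = T * T + y\<^sup>2 *\<^sub>R 1"
  by (simp add: square_plus_def poly_at_pCons)

lemma poly_square_plus: "poly (square_plus y) x = x\<^sup>2 + y\<^sup>2"
  by (simp add: square_plus_def power2_eq_square)

lemma square_plus_pos: "x\<^sup>2 + y\<^sup>2 > 0"
  using y by (simp add: add_nonneg_pos)

lemma energy_pairing:
  "re_state \<phi> (star (T * poly_at r T) * (T * \<xi>)) + y\<^sup>2 * re_state \<phi> (star (poly_at r T) * \<xi>)
   = re_state \<phi> (poly_at (r * square_plus y) T * \<xi>)"
proof -
  have "poly_at r T * T = T * poly_at r T" using poly_at_commute[of r T "[:0, 1:]"] by simp
  then have "T * (poly_at r T * z) = poly_at r T * (T * z)" for z
    by (metis mult.assoc)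
  then show ?thesis
    using sa
    by (simp add: star_mult star_poly_at self_adjoint_def poly_at_mult poly_at_square_plus algebra_simps
        re_state_add[OF st] re_state_scaleR[OF st])
qed

lemma energy_poly: "resolvent_energy \<phi> T y (poly_at r T) = re_state \<phi> (poly_at (r * r * square_plus y) T)"
  using energy_pairing[of r "poly_at r T"]
  by (simp add: resolvent_energy_def poly_at_mult[symmetric] mult_ac)

text \<open>
  The energy is a sum of two positive semidefinite forms, each of which obeys the Cauchy--Schwarz
  inequality. By \<open>energy_pairing\<close>, pairing $r(T)$ with $\xi$ amounts to applying
  $r(T)(T^2 + y^2)$, which is close to the unit when $r$ approximates $1/(x^2 + y^2)$.
\<close>

lemma energy_cauchy_schwarz:
  "(re_state \<phi> (poly_at (r * square_plus y) T * \<xi>))\<^sup>2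
    \<le> resolvent_energy \<phi> T y (poly_at r T) * resolvent_energy \<phi> T y \<xi>"
  unfolding energy_pairing[symmetric] resolvent_energy_def
proof (rule sum_cauchy_schwarz)
  have "(re_state \<phi> (star (poly_at r T) * \<xi>))\<^sup>2
      \<le> re_state \<phi> (star (poly_at r T) * poly_at r T) * re_state \<phi> (star \<xi> * \<xi>)"
    by (rule re_state_cauchy_schwarz[OF st])
  then have "(y\<^sup>2 * y\<^sup>2) * (re_state \<phi> (star (poly_at r T) * \<xi>))\<^sup>2
      \<le> (y\<^sup>2 * y\<^sup>2) * (re_state \<phi> (star (poly_at r T) * poly_at r T) * re_state \<phi> (star \<xi> * \<xi>))"
    by (intro mult_left_mono) auto
  then show "(y\<^sup>2 * re_state \<phi> (star (poly_at r T) * \<xi>))\<^sup>2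
      \<le> (y\<^sup>2 * re_state \<phi> (star (poly_at r T) * poly_at r T)) * (y\<^sup>2 * re_state \<phi> (star \<xi> * \<xi>))"
    by (simp add: power_mult_distrib power2_eq_square mult_ac)
qed (auto intro!: re_state_cauchy_schwarz[OF st] re_state_pos[OF st] mult_nonneg_nonneg)

lemma resolvent_mass_pos: "resolvent_mass (distribution_of \<phi> T) y > 0"
proof -
  interpret real_distribution "distribution_of \<phi> T" by (rule dist_T(1))
  define c where "c = 1 / ((norm T + 1)\<^sup>2 + y\<^sup>2)"
  have c: "c > 0" using square_plus_pos[of "norm T + 1"] by (simp add: c_def)
  have int: "integrable (distribution_of \<phi> T) (\<lambda>x. 1 / (x\<^sup>2 + y\<^sup>2))"
    using square_plus_pos
    by (intro integrable_bounded_support[OF dist_T(2)] continuous_intros) (auto simp: less_imp_neq)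
  have "c = (\<integral>x. c \<partial>distribution_of \<phi> T)" using prob_space by simp
  also have "\<dots> \<le> resolvent_mass (distribution_of \<phi> T) y"
    unfolding resolvent_mass_def
  proof (rule integral_mono_AE[OF _ int])
    show "AE x in distribution_of \<phi> T. c \<le> 1 / (x\<^sup>2 + y\<^sup>2)"
      using dist_T(2)
    proof eventually_elim
      case (elim x)
      then have "x\<^sup>2 \<le> (norm T + 1)\<^sup>2"
        using power_mono[OF elim, of 2] by simp
      then show ?case unfolding c_def using square_plus_pos[of x] by (intro divide_left_mono mult_pos_pos) (auto intro: square_plus_pos)
    qed
  qed simp
  finally show ?thesis using c by simp
qed

text \<open>
  The extremal vector of the variational problem is the resolvent $(T^2 + y^2)^{-1}$. Polynomials
  that converge to $1/(x^2 + y^2)$ uniformly on the support of the distribution replace it.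
\<close>

lemma resolvent_polys:
  obtains r :: "nat \<Rightarrow> real poly" where
    "(\<lambda>k. re_state \<phi> (poly_at (r k) T)) \<longlonglongrightarrow> resolvent_mass (distribution_of \<phi> T) y"
    "(\<lambda>k. resolvent_energy \<phi> T y (poly_at (r k) T)) \<longlonglongrightarrow> resolvent_mass (distribution_of \<phi> T) y"
    "(\<lambda>k. re_state \<phi> (poly_at ((r k * square_plus y - 1)\<^sup>2) T)) \<longlonglongrightarrow> 0"
proof -
  interpret real_distribution "distribution_of \<phi> T" by (rule dist_T(1))
  define K where "K = norm T + 1"
  have K: "AE x in distribution_of \<phi> T. \<bar>x\<bar> \<le> K" using dist_T(2) by (simp add: K_def)
  define f where "f x = 1 / (x\<^sup>2 + y\<^sup>2)" for x
  have fc: "continuous_on S f" for S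
    unfolding f_def using square_plus_pos by (intro continuous_intros) (auto simp: less_imp_neq)
  have fb: "0 \<le> f x" "f x \<le> 1 / y\<^sup>2" for x
    using y by (auto simp: f_def intro!: divide_left_mono mult_pos_pos square_plus_pos)
  have "\<exists>p. \<forall>x. \<bar>x\<bar> \<le> K \<longrightarrow> \<bar>f x - poly p x\<bar> < 1 / real (Suc k)" for k
    using poly_uniform_approx[OF fc, of "1 / real (Suc k)" K] by (metis of_nat_0_less_iff zero_less_Suc zero_less_divide_1_iff)
  then obtain r where r: "\<And>k x. \<bar>x\<bar> \<le> K \<Longrightarrow> \<bar>f x - poly (r k) x\<bar> < 1 / real (Suc k)" by metis
  have lim: "(\<lambda>k. poly (r k) x) \<longlonglongrightarrow> f x" if "\<bar>x\<bar> \<le> K" for x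
  proof -
    have "(\<lambda>k. poly (r k) x - f x) \<longlonglongrightarrow> 0"
    proof (rule Lim_null_comparison[OF always_eventually])
      show "(\<lambda>k. 1 / real (Suc k)) \<longlonglongrightarrow> 0" using LIMSEQ_inverse_real_of_nat by (simp add: inverse_eq_divide)
      show "\<forall>k. norm (poly (r k) x - f x) \<le> 1 / real (Suc k)"
        using r[OF that] by (auto simp: abs_minus_commute less_imp_le)
    qed
    then show ?thesis by (simp add: LIM_zero_iff)
  qed
  define B where "B = 1 / y\<^sup>2 + 1"
  have B0: "B \<ge> 0" by (simp add: B_def)
  have rb: "\<bar>poly (r k) x\<bar> \<le> B" if "\<bar>x\<bar> \<le> K" for k x
  proof -
    have "1 / real (Suc k) \<le> 1" by simp
    then show ?thesis using r[OF that, of k] fb[of x] unfolding B_def by linarith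
  qed
  define C where "C = K\<^sup>2 + y\<^sup>2"
  have C0: "C \<ge> 0" by (simp add: C_def)
  have Cb: "x\<^sup>2 + y\<^sup>2 \<le> C" if "\<bar>x\<bar> \<le> K" for x
    using power_mono[OF that, of 2] by (simp add: C_def)
  have meas[measurable]: "poly p \<in> borel_measurable borel" "f \<in> borel_measurable borel" for p :: "real poly"
    by (intro borel_measurable_continuous_onI continuous_intros fc)+
  have fd: "f x * (x\<^sup>2 + y\<^sup>2) = 1" for x using square_plus_pos[of x] y by (simp add: f_def)
  have "(\<lambda>k. \<integral>x. poly (r k) x \<partial>distribution_of \<phi> T) \<longlonglongrightarrow> (\<integral>x. f x \<partial>distribution_of \<phi> T)"
    by (rule integral_tendsto_bounded_support[OF K lim rb meas])
  moreover have "(\<lambda>k. \<integral>x. poly (r k * r k * square_plus y) x \<partial>distribution_of \<phi> T) \<longlonglongrightarrow> (\<integral>x. f x \<partial>distribution_of \<phi> T)"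
  proof (rule integral_tendsto_bounded_support[OF K _ _ meas])
    fix x assume x: "\<bar>x\<bar> \<le> K"
    have "(\<lambda>k. poly (r k) x * (poly (r k) x * (x\<^sup>2 + y\<^sup>2))) \<longlonglongrightarrow> f x * (f x * (x\<^sup>2 + y\<^sup>2))"
      by (intro tendsto_intros lim[OF x])
    then show "(\<lambda>k. poly (r k * r k * square_plus y) x) \<longlonglongrightarrow> f x" by (simp add: fd poly_square_plus mult.assoc)
    show "\<bar>poly (r k * r k * square_plus y) x\<bar> \<le> B * B * C" for k
    proof -
      have "\<bar>poly (r k) x\<bar> * \<bar>poly (r k) x\<bar> * (x\<^sup>2 + y\<^sup>2) \<le> B * B * C"
        by (rule mult_mono[OF mult_mono[OF rb[OF x] rb[OF x] B0] Cb[OF x]])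
           (use B0 square_plus_pos[of x] in auto)
      then show ?thesis using square_plus_pos[of x] by (simp add: poly_square_plus abs_mult)
    qed
  qed
  moreover have "(\<lambda>k. \<integral>x. poly ((r k * square_plus y - 1)\<^sup>2) x \<partial>distribution_of \<phi> T) \<longlonglongrightarrow> (\<integral>x. 0 \<partial>distribution_of \<phi> T)"
  proof (rule integral_tendsto_bounded_support[OF K])
    fix x assume x: "\<bar>x\<bar> \<le> K"
    have "(\<lambda>k. (poly (r k) x * (x\<^sup>2 + y\<^sup>2) - 1)\<^sup>2) \<longlonglongrightarrow> (f x * (x\<^sup>2 + y\<^sup>2) - 1)\<^sup>2"
      by (intro tendsto_intros lim[OF x])
    then show "(\<lambda>k. poly ((r k * square_plus y - 1)\<^sup>2) x) \<longlonglongrightarrow> 0" by (simp add: fd poly_square_plus)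
    show "\<bar>poly ((r k * square_plus y - 1)\<^sup>2) x\<bar> \<le> (B * C + 1)\<^sup>2" for k
    proof -
      have "\<bar>poly (r k) x * (x\<^sup>2 + y\<^sup>2)\<bar> \<le> B * C"
      proof -
        have "\<bar>poly (r k) x\<bar> * (x\<^sup>2 + y\<^sup>2) \<le> B * C"
          by (rule mult_mono[OF rb[OF x] Cb[OF x] B0]) (rule less_imp_le[OF square_plus_pos])
        then show ?thesis using square_plus_pos[of x] by (simp add: abs_mult)
      qed
      then have "\<bar>poly (r k) x * (x\<^sup>2 + y\<^sup>2) - 1\<bar> \<le> B * C + 1" by linarith
      from power_mono[OF this, of 2] show ?thesis by (simp add: poly_square_plus)
    qed
  qed auto
  ultimately show ?thesis
    unfolding dist_T(3) energy_poly[symmetric] using that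
    by (simp add: resolvent_mass_def f_def)
qed

text \<open>
  Cauchy--Schwarz for the energy of $\xi$ and the approximate resolvent: their pairing tends to
  $\varphi(\xi) = 1$, and the energy of the resolvent is the resolvent mass itself.
\<close>

lemma resolvent_mass_lower:
  assumes \<xi>: "re_state \<phi> \<xi> = 1"
  shows "1 \<le> resolvent_mass (distribution_of \<phi> T) y * resolvent_energy \<phi> T y \<xi>"
proof -
  obtain r :: "nat \<Rightarrow> real poly" where r:
    "(\<lambda>k. re_state \<phi> (poly_at (r k) T)) \<longlonglongrightarrow> resolvent_mass (distribution_of \<phi> T) y"
    "(\<lambda>k. resolvent_energy \<phi> T y (poly_at (r k) T)) \<longlonglongrightarrow> resolvent_mass (distribution_of \<phi> T) y"
    "(\<lambda>k. re_state \<phi> (poly_at ((r k * square_plus y - 1)\<^sup>2) T)) \<longlonglongrightarrow> 0" by (rule resolvent_polys)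
  have bnd: "(re_state \<phi> (poly_at (r k * square_plus y) T * \<xi>) - 1)\<^sup>2
     \<le> re_state \<phi> (poly_at ((r k * square_plus y - 1)\<^sup>2) T) * re_state \<phi> (star \<xi> * \<xi>)" for k
  proof -
    have "re_state \<phi> (poly_at (r k * square_plus y) T * \<xi>) - 1 = re_state \<phi> (star (poly_at (r k * square_plus y - 1) T) * \<xi>)"
      unfolding star_poly_at[OF sa] unfolding poly_at_diff
      using \<xi> by (simp add: left_diff_distrib re_state_diff[OF st])
    then show ?thesis
      using re_state_cauchy_schwarz[OF st, of "poly_at (r k * square_plus y - 1) T" \<xi>]
      by (simp only: star_poly_at[OF sa] power2_eq_square[of "r k * square_plus y - 1"] poly_at_mult[of "r k * square_plus y - 1"])
  qed
  have "(\<lambda>k. (re_state \<phi> (poly_at (r k * square_plus y) T * \<xi>) - 1)\<^sup>2) \<longlonglongrightarrow> 0"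
  proof (rule Lim_null_comparison[OF always_eventually])
    show "(\<lambda>k. re_state \<phi> (poly_at ((r k * square_plus y - 1)\<^sup>2) T) * re_state \<phi> (star \<xi> * \<xi>)) \<longlonglongrightarrow> 0"
      using tendsto_mult_right[OF r(3), of "re_state \<phi> (star \<xi> * \<xi>)"] by simp
  qed (use bnd in auto)
  then have "(\<lambda>k. re_state \<phi> (poly_at (r k * square_plus y) T * \<xi>) - 1) \<longlonglongrightarrow> 0" by simp
  then have "(\<lambda>k. re_state \<phi> (poly_at (r k * square_plus y) T * \<xi>)) \<longlonglongrightarrow> 1" by (simp add: LIM_zero_iff)
  then have "(\<lambda>k. (re_state \<phi> (poly_at (r k * square_plus y) T * \<xi>))\<^sup>2) \<longlonglongrightarrow> 1"
    using tendsto_power[of _ 1 _ 2] by fastforce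
  moreover have "(\<lambda>k. resolvent_energy \<phi> T y (poly_at (r k) T) * resolvent_energy \<phi> T y \<xi>)
      \<longlonglongrightarrow> resolvent_mass (distribution_of \<phi> T) y * resolvent_energy \<phi> T y \<xi>"
    by (intro tendsto_intros r)
  ultimately show ?thesis
    by (rule LIMSEQ_le) (use energy_cauchy_schwarz in auto)
qed

text \<open>
  The approximate resolvent, normalized to have expectation $1$: both its expectation and its
  energy tend to $I$, so the normalized energy tends to $I/I^2$.
\<close>

lemma resolvent_mass_attained:
  assumes "\<epsilon> > 0"
  obtains q where "re_state \<phi> (poly_at q T) = 1"
    "resolvent_energy \<phi> T y (poly_at q T) < 1 / resolvent_mass (distribution_of \<phi> T) y + \<epsilon>"
proof -
  define I where "I = resolvent_mass (distribution_of \<phi> T) y"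
  have I: "I > 0" using resolvent_mass_pos by (simp add: I_def)
  obtain r :: "nat \<Rightarrow> real poly" where r:
    "(\<lambda>k. re_state \<phi> (poly_at (r k) T)) \<longlonglongrightarrow> I"
    "(\<lambda>k. resolvent_energy \<phi> T y (poly_at (r k) T)) \<longlonglongrightarrow> I" 
    unfolding I_def by (rule resolvent_polys)
  have "(\<lambda>k. resolvent_energy \<phi> T y (poly_at (r k) T) / (re_state \<phi> (poly_at (r k) T))\<^sup>2) \<longlonglongrightarrow> I / I\<^sup>2"
    using I by (intro tendsto_intros r) auto
  also have "I / I\<^sup>2 = 1 / I" using I by (simp add: power2_eq_square)
  finally have "\<forall>\<^sub>F k in sequentially.
      resolvent_energy \<phi> T y (poly_at (r k) T) / (re_state \<phi> (poly_at (r k) T))\<^sup>2 < 1 / I + \<epsilon>"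
    using assms by (intro order_tendstoD(2)) auto
  moreover have "\<forall>\<^sub>F k in sequentially. re_state \<phi> (poly_at (r k) T) > 0"
    using r(1) I by (rule order_tendstoD(1))
  ultimately have "\<forall>\<^sub>F k in sequentially. re_state \<phi> (poly_at (r k) T) > 0 \<and>
      resolvent_energy \<phi> T y (poly_at (r k) T) / (re_state \<phi> (poly_at (r k) T))\<^sup>2 < 1 / I + \<epsilon>"
    by eventually_elim simp
  then obtain k where k: "re_state \<phi> (poly_at (r k) T) > 0"
      "resolvent_energy \<phi> T y (poly_at (r k) T) / (re_state \<phi> (poly_at (r k) T))\<^sup>2 < 1 / I + \<epsilon>"
    by (auto dest: eventually_happens)
  define c where "c = 1 / re_state \<phi> (poly_at (r k) T)"
  have "re_state \<phi> (poly_at (smult c (r k)) T) = 1"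
    using k(1) by (simp add: poly_at_smult re_state_scaleR[OF st] c_def)
  moreover have "resolvent_energy \<phi> T y (poly_at (smult c (r k)) T)
      = c\<^sup>2 * resolvent_energy \<phi> T y (poly_at (r k) T)"
    by (simp add: resolvent_energy_def poly_at_smult star_scaleR
        re_state_scaleR[OF st] power2_eq_square algebra_simps)
  moreover have "c\<^sup>2 * resolvent_energy \<phi> T y (poly_at (r k) T) < 1 / I + \<epsilon>"
    using k(2) by (simp add: c_def power_divide)
  ultimately show ?thesis using that unfolding I_def by metis
qed

end

context boolean_iid
begin

lemma self_adjoint_clt_sum: "self_adjoint (clt_sum n)"
  using sa by (auto simp: clt_sum_def self_adjoint_def star_scaleR linear_sum[OF linear_star] intro!: sum.cong)

lemma resolvent_mass_antimono:
  assumes n: "1 \<le> n" "n \<le> m" and y: "y > 0"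
  shows "resolvent_mass (distribution_of \<phi> (clt_sum m)) y \<le> resolvent_mass (distribution_of \<phi> (clt_sum n)) y"
proof -
  define Im where "Im = resolvent_mass (distribution_of \<phi> (clt_sum m)) y"
  define In where "In = resolvent_mass (distribution_of \<phi> (clt_sum n)) y"
  have pos: "Im > 0" "In > 0"
    using resolvent_mass_pos[OF st self_adjoint_clt_sum y] by (auto simp: Im_def In_def)
  have "1 / In \<le> 1 / Im + \<epsilon>" if e: "\<epsilon> > 0" for \<epsilon>
  proof -
    obtain q where q: "re_state \<phi> (poly_at q (clt_sum m)) = 1"
        "resolvent_energy \<phi> (clt_sum m) y (poly_at q (clt_sum m)) < 1 / Im + \<epsilon>"
      using resolvent_mass_attained[OF st self_adjoint_clt_sum y e] unfolding Im_def by metis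
    obtain \<xi> where \<xi>: "re_state \<phi> \<xi> = 1"
      "resolvent_energy \<phi> (clt_sum n) y \<xi> \<le> resolvent_energy \<phi> (clt_sum m) y (poly_at q (clt_sum m))"
      using resolvent_energy_decreases[OF n q(1)] by blast
    have "1 \<le> In * resolvent_energy \<phi> (clt_sum n) y \<xi>"
      unfolding In_def by (rule resolvent_mass_lower[OF st self_adjoint_clt_sum y \<xi>(1)])
    then have "1 / In \<le> resolvent_energy \<phi> (clt_sum n) y \<xi>" using pos by (simp add: field_simps)
    with \<xi> q show ?thesis by linarith
  qed
  then have "1 / In \<le> 1 / Im" by (rule field_le_epsilon)
  then show ?thesis using pos by (simp add: Im_def In_def field_simps)
qed

end

section \<open>From resolvents to logarithmic integrals\<close>

lemma log_abs_measurable [measurable]: "log_abs \<in> borel_measurable borel"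
  unfolding log_abs_def[abs_def] by measurable

lemma log_abs_le: "\<bar>x\<bar> \<le> exp C \<Longrightarrow> log_abs x \<le> ereal C"
  by (auto simp: log_abs_def) (metis exp_gt_zero ln_exp ln_le_cancel_iff zero_less_abs_iff)

lemma e2ennreal_ereal: "e2ennreal (ereal r) = ennreal r"
  by (simp add: ennreal.abs_eq e2ennreal_def[symmetric] ennreal_def)

text \<open>
  An upper bound $C$ of $\log|x|$ makes the positive part integrable, and subtracting from $C$
  leaves a single integral of a nonnegative function. This avoids differences of
  possibly infinite integrals when measures are compared.
\<close>

lemma Gam_eq_shifted:
  assumes M: "real_distribution M" and C: "C \<ge> 0" and bd: "AE x in M. log_abs x \<le> ereal C"
  shows "Gam M = ereal C - enn2ereal (\<integral>\<^sup>+ x. e2ennreal (ereal C - log_abs x) \<partial>M)"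
proof -
  interpret M: real_distribution M by fact
  define P where "P = (\<integral>\<^sup>+ x. e2ennreal (log_abs x) \<partial>M)"
  define N where "N = (\<integral>\<^sup>+ x. e2ennreal (- log_abs x) \<partial>M)"
  define N' where "N' = (\<integral>\<^sup>+ x. e2ennreal (ereal C - log_abs x) \<partial>M)"
  have "(\<integral>\<^sup>+ x. e2ennreal (ereal C - log_abs x) + e2ennreal (log_abs x) \<partial>M)
      = (\<integral>\<^sup>+ x. ennreal C + e2ennreal (- log_abs x) \<partial>M)"
  proof (rule nn_integral_cong_AE)
    show "AE x in M. e2ennreal (ereal C - log_abs x) + e2ennreal (log_abs x)
        = ennreal C + e2ennreal (- log_abs x)"
      using bd
    proof eventually_elim
      case (elim x)
      show ?case
      proof (cases "x = 0")
        case True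
        then show ?thesis by (simp add: log_abs_def e2ennreal_infty e2ennreal_neg)
      next
        case False
        define l where "l = ln \<bar>x\<bar>"
        have l: "log_abs x = ereal l" using False by (simp add: log_abs_def l_def)
        then have "l \<le> C" using elim by simp
        then have "ennreal (C - l) + ennreal l = ennreal C + ennreal (- l)"
          using C by (cases "l \<ge> 0") (auto simp: ennreal_plus[symmetric] ennreal_neg simp del: ennreal_plus)
        then show ?thesis by (simp add: l e2ennreal_ereal)
      qed
    qed
  qed
  then have "N' + P = ennreal C + N"
    unfolding N_def P_def N'_def
    by (simp add: nn_integral_add M.emeasure_space_1[unfolded M.space_eq_univ])
  moreover have "P \<le> ennreal C"
  proof -
    have "P \<le> (\<integral>\<^sup>+ x. ennreal C \<partial>M)"
      unfolding P_def
    proof (rule nn_integral_mono_AE)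
      show "AE x in M. e2ennreal (log_abs x) \<le> ennreal C"
        using bd by eventually_elim (metis e2ennreal_ereal e2ennreal_mono)
    qed
    then show ?thesis by (simp add: M.emeasure_space_1[unfolded M.space_eq_univ])
  qed
  then obtain p where p: "P = ennreal p" "p \<ge> 0" by (cases P) (auto simp: top_unique)
  show ?thesis
  proof (cases N)
    case top
    then have "N' = \<top>" using \<open>N' + P = ennreal C + N\<close> p by (cases N') (auto simp: ennreal_plus[symmetric] simp del: ennreal_plus)
    then show ?thesis
      using top p unfolding Gam_def P_def[symmetric] N_def[symmetric] N'_def[symmetric]
      by (simp add: top_ereal_def)
  next
    case (real n)
    then have "N' \<noteq> \<top>"
      using \<open>N' + P = ennreal C + N\<close> p C by (auto simp: ennreal_plus[symmetric] simp del: ennreal_plus)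
    then obtain n' where n': "N' = ennreal n'" "n' \<ge> 0" by (cases N') auto
    have "n' + p = C + n"
      using \<open>N' + P = ennreal C + N\<close> p n' real C by (simp add: ennreal_plus[symmetric] del: ennreal_plus)
    then show ?thesis
      using real p n' unfolding Gam_def P_def[symmetric] N_def[symmetric] N'_def[symmetric]
      by (simp add: enn2ereal_ennreal)
  qed
qed

lemma nn_integral_inverse_shift:
  assumes R: "R > 0" and x: "x \<noteq> 0"
  shows "(\<integral>\<^sup>+ s. ennreal (1 / (2 * (x\<^sup>2 + s))) * indicator {0..R\<^sup>2} s \<partial>lborel)
       = ennreal (ln ((x\<^sup>2 + R\<^sup>2) / x\<^sup>2) / 2)"
proof -
  have x2: "x\<^sup>2 > 0" using x by simp
  have "(\<integral>\<^sup>+ s. ennreal (1 / (2 * (x\<^sup>2 + s))) * indicator {0..R\<^sup>2} s \<partial>lborel)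
     = ennreal (ln (x\<^sup>2 + R\<^sup>2) / 2 - ln (x\<^sup>2 + 0) / 2)"
  proof (rule nn_integral_FTC_Icc[where F = "\<lambda>s. ln (x\<^sup>2 + s) / 2"])
    fix s assume "s \<in> {0..R\<^sup>2}"
    then have s: "x\<^sup>2 + s > 0" by (intro add_pos_nonneg[OF x2]) simp
    then have "((\<lambda>s. ln (x\<^sup>2 + s)) has_field_derivative 1 / (x\<^sup>2 + s)) (at s)"
      by (auto intro!: derivative_eq_intros)
    from DERIV_cdivide[OF this, of 2]
    show "((\<lambda>s. ln (x\<^sup>2 + s) / 2) has_field_derivative 1 / (2 * (x\<^sup>2 + s))) (at s)"
      by (simp only: divide_divide_eq_left mult.commute)
    show "0 \<le> 1 / (2 * (x\<^sup>2 + s))" using s by simp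
  qed auto
  also have "ln (x\<^sup>2 + R\<^sup>2) / 2 - ln (x\<^sup>2 + 0) / 2 = ln ((x\<^sup>2 + R\<^sup>2) / x\<^sup>2) / 2"
    using x2 R by (simp add: ln_div add_pos_pos diff_divide_distrib)
  finally show ?thesis .
qed

lemma nn_integral_inverse_top:
  assumes R: "R > 0"
  shows "(\<integral>\<^sup>+ s. ennreal (1 / (2 * s)) * indicator {0..R\<^sup>2} s \<partial>lborel) = \<top>" (is "?I = _")
proof -
  have "ennreal c \<le> (\<integral>\<^sup>+ s. ennreal (1 / (2 * s)) * indicator {0..R\<^sup>2} s \<partial>lborel)" if c: "c \<ge> 0" for c
  proof -
    \<comment> \<open>chosen so that the integral over $[\delta, R^2]$ is exactly $c$\<close>
    define \<delta> where "\<delta> = R\<^sup>2 * exp (- 2 * c)"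
    have \<delta>: "\<delta> > 0" "\<delta> \<le> R\<^sup>2" using R c by (auto simp: \<delta>_def mult_left_le)
    have "ennreal c = ennreal (ln (R\<^sup>2) / 2 - ln \<delta> / 2)"
      using R by (simp add: \<delta>_def ln_mult diff_divide_distrib)
    also have "\<dots> = (\<integral>\<^sup>+ s. ennreal (1 / (2 * s)) * indicator {\<delta>..R\<^sup>2} s \<partial>lborel)"
      using \<delta>
      by (intro nn_integral_FTC_Icc[symmetric]) (auto intro!: derivative_eq_intros simp: field_simps)
    also have "\<dots> \<le> (\<integral>\<^sup>+ s. ennreal (1 / (2 * s)) * indicator {0..R\<^sup>2} s \<partial>lborel)"
      using \<delta> by (intro nn_integral_mono mult_left_mono) (auto simp: indicator_def)
    finally show ?thesis .
  qed
  then have le: "ennreal c \<le> ?I" if "c \<ge> 0" for c using that by blast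
  show ?thesis
  proof (cases ?I)
    case (real v)
    then have "v + 1 \<le> v" using le[of "v + 1"] by simp
    then show ?thesis by simp
  qed
qed

text \<open>
  For $x \ne 0$ this is $\frac12 \log((x^2 + R^2)/x^2)$; at $x = 0$ the integral diverges, in
  agreement with $-\log 0 = \infty$.
\<close>

definition log_kernel :: "real \<Rightarrow> real \<Rightarrow> ennreal" where
  "log_kernel R x = (\<integral>\<^sup>+ s. ennreal (1 / (2 * (x\<^sup>2 + s))) * indicator {0..R\<^sup>2} s \<partial>lborel)"

text \<open>
  For $x \neq 0$ the kernel exceeds $\log R - \log|x|$ by $\frac12\log(1 + x^2/R^2)$,
  which is at most $K^2/R^2$.
\<close>

lemma log_kernel_bounds:
  assumes R: "R > 0" and x: "\<bar>x\<bar> \<le> K" "K \<le> R"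
  shows "e2ennreal (ereal (ln R) - log_abs x) \<le> log_kernel R x"
    and "log_kernel R x \<le> e2ennreal (ereal (ln R) - log_abs x) + ennreal (K\<^sup>2 / R\<^sup>2)"
proof -
  have "e2ennreal (ereal (ln R) - log_abs x) \<le> log_kernel R x \<and>
     log_kernel R x \<le> e2ennreal (ereal (ln R) - log_abs x) + ennreal (K\<^sup>2 / R\<^sup>2)"
  proof (cases "x = 0")
    case True
    then show ?thesis
      using nn_integral_inverse_top[OF R] by (simp add: log_kernel_def log_abs_def e2ennreal_infty)
  next
    case False
    define t where "t = ln (1 + x\<^sup>2 / R\<^sup>2) / 2"
    have x0: "\<bar>x\<bar> > 0" "x\<^sup>2 > 0" using False by auto
    have "ln ((x\<^sup>2 + R\<^sup>2) / x\<^sup>2) = ln ((1 + x\<^sup>2 / R\<^sup>2) * (R\<^sup>2 / x\<^sup>2))"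
      using x0 R by (intro arg_cong[where f = ln]) (simp add: field_simps)
    also have "\<dots> = ln (1 + x\<^sup>2 / R\<^sup>2) + (2 * ln R - 2 * ln \<bar>x\<bar>)"
    proof -
      have "ln (x\<^sup>2) = 2 * ln \<bar>x\<bar>" using x0 ln_realpow[of "\<bar>x\<bar>" 2] by simp
      moreover have "1 + x\<^sup>2 / R\<^sup>2 > 0" by (intro add_pos_nonneg) auto
      ultimately show ?thesis using x0 R by (simp add: ln_mult ln_div ln_realpow)
    qed
    finally have eq: "ln ((x\<^sup>2 + R\<^sup>2) / x\<^sup>2) / 2 = t + (ln R - ln \<bar>x\<bar>)" by (simp add: t_def)
    have t0: "t \<ge> 0" by (simp add: t_def)
    have "ln (1 + x\<^sup>2 / R\<^sup>2) \<le> x\<^sup>2 / R\<^sup>2" by (rule ln_add_one_self_le_self) simp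
    also have "\<dots> \<le> K\<^sup>2 / R\<^sup>2" using power_mono[OF x(1), of 2] by (intro divide_right_mono) auto
    finally have t1: "t \<le> K\<^sup>2 / R\<^sup>2" using t0 unfolding t_def by linarith
    have l0: "ln R - ln \<bar>x\<bar> \<ge> 0" using x0 x R by simp
    have "log_kernel R x = ennreal (t + (ln R - ln \<bar>x\<bar>))"
      unfolding log_kernel_def nn_integral_inverse_shift[OF R False] eq ..
    moreover have "e2ennreal (ereal (ln R) - log_abs x) = ennreal (ln R - ln \<bar>x\<bar>)"
      using False by (simp add: log_abs_def e2ennreal_ereal)
    ultimately show ?thesis
      using t0 t1 l0 by (simp add: ennreal_plus[symmetric] ennreal_leI del: ennreal_plus)
  qed
  then show "e2ennreal (ereal (ln R) - log_abs x) \<le> log_kernel R x"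
    and "log_kernel R x \<le> e2ennreal (ereal (ln R) - log_abs x) + ennreal (K\<^sup>2 / R\<^sup>2)" by auto
qed

text \<open>
  By Tonelli's theorem the integral of the kernel is an integral of resolvent masses over
  $s = y^2$.
\<close>

lemma nn_integral_log_kernel_mono:
  assumes M: "real_distribution M" and N: "real_distribution N"
    and le: "\<And>y. y > 0 \<Longrightarrow> resolvent_mass N y \<le> resolvent_mass M y"
  shows "(\<integral>\<^sup>+ x. log_kernel R x \<partial>N) \<le> (\<integral>\<^sup>+ x. log_kernel R x \<partial>M)"
proof -
  have tonelli: "(\<integral>\<^sup>+ x. log_kernel R x \<partial>D)
      = (\<integral>\<^sup>+ s. (\<integral>\<^sup>+ x. ennreal (1 / (2 * (x\<^sup>2 + s))) * indicator {0..R\<^sup>2} s \<partial>D) \<partial>lborel)"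
    if "real_distribution D" for D
  proof -
    interpret D: real_distribution D by fact
    interpret pair_sigma_finite D lborel by standard
    show ?thesis
      unfolding log_kernel_def by (rule Fubini'[symmetric]) simp
  qed
  have inner: "(\<integral>\<^sup>+ x. ennreal (1 / (2 * (x\<^sup>2 + s))) * indicator {0..R\<^sup>2} s \<partial>D)
      = ennreal (resolvent_mass D (sqrt s) / 2) * indicator {0..R\<^sup>2} s"
    if "real_distribution D" "s > 0" for D s
  proof -
    interpret D: real_distribution D by fact
    have "integrable D (\<lambda>x. 1 / (2 * (x\<^sup>2 + s)))"
    proof (rule D.integrable_const_bound[of _ "1 / s"])
      have "1 / (2 * (x\<^sup>2 + s)) \<le> 1 / s" for x
        using that(2) zero_le_power2[of x] by (intro divide_left_mono mult_pos_pos) (auto simp: add_nonneg_pos)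
      moreover have "0 \<le> 1 / (2 * (x\<^sup>2 + s))" for x using that(2) by (simp add: add_nonneg_pos less_imp_le)
      ultimately show "AE x in D. norm (1 / (2 * (x\<^sup>2 + s))) \<le> 1 / s"
        by (simp only: real_norm_def abs_of_nonneg AE_I2)
    qed simp
    then have "(\<integral>\<^sup>+ x. ennreal (1 / (2 * (x\<^sup>2 + s))) \<partial>D) = ennreal (\<integral>x. 1 / (2 * (x\<^sup>2 + s)) \<partial>D)"
      using that(2) by (intro nn_integral_eq_integral) (auto simp: add_nonneg_pos less_imp_le)
    also have "(\<integral>x. 1 / (2 * (x\<^sup>2 + s)) \<partial>D) = (\<integral>x. (1 / (x\<^sup>2 + s)) / 2 \<partial>D)"
      by (simp add: mult.commute)
    also have "\<dots> = resolvent_mass D (sqrt s) / 2"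
      using that(2) unfolding resolvent_mass_def by (subst integral_divide_zero) simp
    finally show ?thesis
      by (simp add: nn_integral_multc)
  qed
  show ?thesis
    unfolding tonelli[OF M] tonelli[OF N]
  proof (rule nn_integral_mono_AE)
    have "AE s in lborel. s \<noteq> (0::real)" by (rule AE_lborel_singleton)
    then show "AE s in lborel.
       (\<integral>\<^sup>+ x. ennreal (1 / (2 * (x\<^sup>2 + s))) * indicator {0..R\<^sup>2} s \<partial>N)
       \<le> (\<integral>\<^sup>+ x. ennreal (1 / (2 * (x\<^sup>2 + s))) * indicator {0..R\<^sup>2} s \<partial>M)"
    proof eventually_elim
      case (elim s)
      show ?case
      proof (cases "s > 0")
        case True
        then show ?thesis
          unfolding inner[OF M True] inner[OF N True]
          using le[of "sqrt s"] by (intro mult_right_mono ennreal_leI) auto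
      next
        case False
        with elim show ?thesis by simp
      qed
    qed
  qed
qed

text \<open>
  For large $R$ the kernel equals $\log R - \log|x|$ up to an arbitrarily small error on both
  supports, so comparing the kernel integrals compares the logarithmic ones.
\<close>

theorem Gam_mono_resolvent_mass:
  assumes M: "real_distribution M" and N: "real_distribution N"
    and b: "AE x in M. \<bar>x\<bar> \<le> K" "AE x in N. \<bar>x\<bar> \<le> K"
    and le: "\<And>y. y > 0 \<Longrightarrow> resolvent_mass N y \<le> resolvent_mass M y"
  shows "Gam M \<le> Gam N"
proof (rule ereal_le_epsilon2)
  interpret M: real_distribution M by fact
  interpret N: real_distribution N by fact
  fix e :: real assume e: "e > 0"
  have "(\<lambda>k. K\<^sup>2 / (real k)\<^sup>2) \<longlonglongrightarrow> 0"
    using tendsto_mult_right_zero[OF tendsto_power[OF lim_1_over_n, of 2, simplified], of "K\<^sup>2"]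
    by (simp add: power_divide)
  then have "\<forall>\<^sub>F k in sequentially. K\<^sup>2 / (real k)\<^sup>2 < e"
    using e by (rule order_tendstoD(2))
  moreover have "\<forall>\<^sub>F k in sequentially. real k \<ge> max 1 K"
    by (rule eventually_sequentiallyI[of "nat \<lceil>max 1 K\<rceil>"]) linarith
  ultimately have "\<forall>\<^sub>F k in sequentially. K\<^sup>2 / (real k)\<^sup>2 < e \<and> real k \<ge> max 1 K"
    by eventually_elim simp
  then obtain k where k: "K\<^sup>2 / (real k)\<^sup>2 < e" "real k \<ge> max 1 K"
    by (auto dest: eventually_happens)
  define R where "R = real k"
  have R: "R > 0" "R \<ge> 1" "K \<le> R" "K\<^sup>2 / R\<^sup>2 < e" using k by (auto simp: R_def)
  define n where "n D = (\<integral>\<^sup>+ x. e2ennreal (ereal (ln R) - log_abs x) \<partial>D)" for D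
  have Gam: "Gam D = ereal (ln R) - enn2ereal (n D)"
    if "real_distribution D" "AE x in D. \<bar>x\<bar> \<le> K" for D
    unfolding n_def
  proof (rule Gam_eq_shifted[OF that(1)])
    show "AE x in D. log_abs x \<le> ereal (ln R)"
      using that(2) by eventually_elim (rule log_abs_le, use R in simp)
  qed (use R in simp)
  have meas: "log_kernel R \<in> borel_measurable borel"
    unfolding log_kernel_def[abs_def] by measurable
  have "n N \<le> (\<integral>\<^sup>+ x. log_kernel R x \<partial>N)"
    unfolding n_def
  proof (rule nn_integral_mono_AE)
    show "AE x in N. e2ennreal (ereal (ln R) - log_abs x) \<le> log_kernel R x"
      using b(2) by eventually_elim (rule log_kernel_bounds(1)[OF R(1) _ R(3)])
  qed
  also have "\<dots> \<le> (\<integral>\<^sup>+ x. log_kernel R x \<partial>M)"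
    by (rule nn_integral_log_kernel_mono[OF M N le])
  also have "\<dots> \<le> (\<integral>\<^sup>+ x. e2ennreal (ereal (ln R) - log_abs x) + ennreal (K\<^sup>2 / R\<^sup>2) \<partial>M)"
  proof (rule nn_integral_mono_AE)
    show "AE x in M. log_kernel R x \<le> e2ennreal (ereal (ln R) - log_abs x) + ennreal (K\<^sup>2 / R\<^sup>2)"
      using b(1) by eventually_elim (rule log_kernel_bounds(2)[OF R(1) _ R(3)])
  qed
  also have "\<dots> = n M + ennreal (K\<^sup>2 / R\<^sup>2)"
    unfolding n_def by (simp add: nn_integral_add M.emeasure_space_1[unfolded M.space_eq_univ])
  also have "\<dots> \<le> n M + ennreal e" using R(4) by (intro add_left_mono ennreal_leI) simp
  finally have key: "n N \<le> n M + ennreal e" .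
  show "Gam M \<le> Gam N + ereal e"
  proof (cases "n M")
    case top
    then show ?thesis unfolding Gam[OF M b(1)] by (simp add: top_ereal_def)
  next
    case (real u)
    then obtain v where v: "n N = ennreal v" "v \<ge> 0"
      using key by (cases "n N") (auto simp: ennreal_plus[symmetric] top_unique simp del: ennreal_plus)
    have "v \<le> u + e"
      using key real v e by (simp add: ennreal_plus[symmetric] del: ennreal_plus)
    then show ?thesis
      unfolding Gam[OF M b(1)] Gam[OF N b(2)] using real v by (simp add: enn2ereal_ennreal)
  qed
qed

section \<open>Maximizers and monotonicity\<close>

text \<open>
  The measure is the image of a Bernoulli distribution, from which both properties are inherited.
\<close>

lemma two_point_eq:
  assumes p: "p \<in> {0..1}"
  shows "real_distribution (two_point p)"
    and "f \<in> borel_measurable borel \<Longrightarrow>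
         (\<integral>\<^sup>+ x. f x \<partial>two_point p) = ennreal p * f (-1) + ennreal (1 - p) * f 1"
proof -
  define D where "D = distr (measure_pmf (bernoulli_pmf p)) borel (\<lambda>b. if b then -1 else 1 :: real)"
  have nn: "(\<integral>\<^sup>+ x. g x \<partial>D) = ennreal p * g (-1) + ennreal (1 - p) * g 1"
    if "g \<in> borel_measurable borel" for g :: "real \<Rightarrow> ennreal"
    using p that
    by (simp add: D_def nn_integral_distr mult.commute)
  have em: "emeasure D A = ennreal p * emeasure (return borel (-1)) A
         + ennreal (1 - p) * emeasure (return borel 1) A" if "A \<in> sets borel" for A
  proof -
    have "emeasure D A = (\<integral>\<^sup>+ x. indicator A x \<partial>D)"
      using that by (simp add: D_def)
    also have "\<dots> = ennreal p * indicator A (-1) + ennreal (1 - p) * indicator A 1"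
      by (rule nn) (use that in simp)
    finally show ?thesis using that by simp
  qed
  have "two_point p = measure_of (space D) (sets D) (emeasure D)"
    unfolding two_point_def
    by (rule measure_of_eq[symmetric, THEN trans])
       (auto simp: D_def em[unfolded D_def] sets.sigma_sets_eq[of borel, simplified] intro: measure_of_eq)
  then have eq: "two_point p = D" by (simp add: measure_of_of_measure)
  show "real_distribution (two_point p)"
    unfolding eq D_def
    by (rule prob_space.real_distribution_distr) (auto intro: measure_pmf.prob_space_axioms)
  show "(\<integral>\<^sup>+ x. f x \<partial>two_point p) = ennreal p * f (-1) + ennreal (1 - p) * f 1"
    if "f \<in> borel_measurable borel"
    unfolding eq by (rule nn[OF that])
qed

lemma second_moment_two_point: "p \<in> {0..1} \<Longrightarrow> second_moment (two_point p) = 1"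
  unfolding second_moment_def
  by (subst two_point_eq(2)) (auto simp flip: ennreal_plus)

lemma Gam_two_point: "p \<in> {0..1} \<Longrightarrow> Gam (two_point p) = 0"
  unfolding Gam_def
  by (simp add: two_point_eq(2) log_abs_def e2ennreal_ereal e2ennreal_neg zero_ereal_def[symmetric])

text \<open>
  The inequality $\log|x| + \frac12 \le \frac12 x^2$ is integrated with the negative part of the
  logarithm moved to the right, where its integral may be infinite.
\<close>

lemma Gam_le_0_of_second_moment:
  assumes M: "real_distribution M" and m2: "second_moment M = 1"
  shows "Gam M \<le> 0"
proof -
  interpret M: real_distribution M by fact
  define P where "P = (\<integral>\<^sup>+ x. e2ennreal (log_abs x) \<partial>M)"
  define N where "N = (\<integral>\<^sup>+ x. e2ennreal (- log_abs x) \<partial>M)"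
  have pt: "e2ennreal (log_abs x) + ennreal (1/2) \<le> ennreal (1/2) * ennreal (x\<^sup>2) + e2ennreal (- log_abs x)" for x
  proof (cases "x = 0")
    case True
    then show ?thesis by (simp add: log_abs_def e2ennreal_infty e2ennreal_neg)
  next
    case False
    define l where "l = ln \<bar>x\<bar>"
    have "x\<^sup>2 > 0" using False by simp
    then have "ln (x\<^sup>2) \<le> x\<^sup>2 - 1" by (rule ln_le_minus_one)
    moreover have "ln (x\<^sup>2) = 2 * l" using False ln_realpow[of "\<bar>x\<bar>" 2] by (simp add: l_def)
    ultimately have l: "l + 1/2 \<le> x\<^sup>2 / 2" by linarith
    have "ennreal l + ennreal (1/2) \<le> ennreal (x\<^sup>2 / 2) + ennreal (- l)"
    proof (cases "l \<ge> 0")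
      case True
      have "ennreal l + ennreal (1/2) = ennreal (l + 1/2)"
        using True by (intro ennreal_plus[symmetric]) auto
      also have "\<dots> \<le> ennreal (x\<^sup>2 / 2)" using l by (rule ennreal_leI)
      finally show ?thesis by (rule order.trans) simp
    next
      case False
      then have "ennreal l + ennreal (1/2) = ennreal (1/2)" by (simp only: ennreal_neg add_0)
      also have "\<dots> \<le> ennreal (x\<^sup>2 / 2 + - l)" using l by (intro ennreal_leI) linarith
      also have "\<dots> = ennreal (x\<^sup>2 / 2) + ennreal (- l)"
        using False by (intro ennreal_plus) auto
      finally show ?thesis .
    qed
    moreover have "ennreal (1/2) * ennreal (x\<^sup>2) = ennreal (x\<^sup>2 / 2)"
      using ennreal_mult[of "1/2" "x\<^sup>2"] by simp
    moreover have "log_abs x = ereal l" using False by (simp add: log_abs_def l_def)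
    ultimately show ?thesis by (simp add: e2ennreal_ereal)
  qed
  have sm: "(\<integral>\<^sup>+ x. ennreal (x\<^sup>2) \<partial>M) = 1" using m2 by (simp add: second_moment_def)
  have "(\<integral>\<^sup>+ x. e2ennreal (log_abs x) + ennreal (1/2) \<partial>M)
      \<le> (\<integral>\<^sup>+ x. ennreal (1/2) * ennreal (x\<^sup>2) + e2ennreal (- log_abs x) \<partial>M)"
    by (intro nn_integral_mono pt)
  then have "P + ennreal (1/2) \<le> ennreal (1/2) + N"
    by (simp add: nn_integral_add nn_integral_cmult sm P_def N_def
        M.emeasure_space_1[unfolded M.space_eq_univ])
  then have PN: "P \<le> N" by (simp add: add.commute)
  show ?thesis
    unfolding Gam_def P_def[symmetric] N_def[symmetric]
  proof (cases "N = \<top>")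
    case False
    then obtain n where n: "N = ennreal n" "n \<ge> 0" by (cases N) auto
    then obtain p where "P = ennreal p" "p \<ge> 0" using PN by (cases P) (auto simp: top_unique)
    with n PN show "enn2ereal P - enn2ereal N \<le> 0" by (simp add: enn2ereal_ennreal)
  next
    case True
    have "P \<noteq> \<top>"
    proof -
      have "e2ennreal (log_abs x) \<le> ennreal (x\<^sup>2)" for x
      proof (cases "x = 0")
        case False
        then have "ln \<bar>x\<bar> \<le> \<bar>x\<bar> - 1" by (intro ln_le_minus_one) simp
        also have "\<dots> \<le> x\<^sup>2" using zero_le_power2[of "\<bar>x\<bar> - 1"] by (simp add: power2_eq_square algebra_simps)
        finally show ?thesis using False by (simp add: log_abs_def e2ennreal_ereal ennreal_leI)
      qed (simp add: log_abs_def e2ennreal_neg)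
      then have "P \<le> (\<integral>\<^sup>+ x. ennreal (x\<^sup>2) \<partial>M)" unfolding P_def by (intro nn_integral_mono)
      then show ?thesis by (auto simp: sm top_unique)
    qed
    then show "enn2ereal P - enn2ereal N \<le> 0" using True by (cases P) (auto simp: top_ereal_def)
  qed
qed

theorem theorem1p4:
  shows "(\<forall>p\<in>{0..1}.
            is_arg_max Gam (\<lambda>\<mu>. real_distribution \<mu> \<and> second_moment \<mu> = 1) (two_point p))
       \<and> (\<forall>(\<phi> :: 'a::cstar_algebra \<Rightarrow> complex) (a :: nat \<Rightarrow> 'a).
            state \<phi> \<and>
            (\<forall>i\<ge>1. self_adjoint (a i)) \<and>
            identically_distributed \<phi> {1..} a \<and>
            boolean_independent \<phi> {1..} (\<lambda>i. Alg (a i)) \<and>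
            Gam_rv \<phi> (a 1) > - \<infinity>
            \<longrightarrow> mono_on {1..} (\<lambda>n::nat. Gam_rv \<phi> ((1 / sqrt (real n)) *\<^sub>R (\<Sum>i=1..n. a i))))"
proof (intro conjI ballI allI impI)
  fix p :: real assume p: "p \<in> {0..1}"
  show "is_arg_max Gam (\<lambda>\<mu>. real_distribution \<mu> \<and> second_moment \<mu> = 1) (two_point p)"
    unfolding is_arg_max_def
    using two_point_eq(1)[OF p] second_moment_two_point[OF p] Gam_two_point[OF p]
      Gam_le_0_of_second_moment by (auto simp: not_less)
next
  fix \<phi> :: "'a \<Rightarrow> complex" and a :: "nat \<Rightarrow> 'a"
  assume A: "state \<phi> \<and> (\<forall>i\<ge>1. self_adjoint (a i)) \<and> identically_distributed \<phi> {1..} a \<and>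
     boolean_independent \<phi> {1..} (\<lambda>i. Alg (a i)) \<and> Gam_rv \<phi> (a 1) > - \<infinity>"
  then interpret boolean_iid \<phi> a by unfold_locales auto
  show "mono_on {1..} (\<lambda>n::nat. Gam_rv \<phi> ((1 / sqrt (real n)) *\<^sub>R (\<Sum>i=1..n. a i)))"
    unfolding clt_sum_def[symmetric] Gam_rv_def
  proof (rule mono_onI)
    fix n m :: nat assume n: "n \<in> {1..}" "m \<in> {1..}" "n \<le> m"
    define K where "K = max (norm (clt_sum n)) (norm (clt_sum m)) + 1"
    have K: "norm (clt_sum n) < K" "norm (clt_sum m) < K" by (auto simp: K_def)
    show "Gam (distribution_of \<phi> (clt_sum n)) \<le> Gam (distribution_of \<phi> (clt_sum m))"
    proof (rule Gam_mono_resolvent_mass)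
      show "resolvent_mass (distribution_of \<phi> (clt_sum m)) y \<le> resolvent_mass (distribution_of \<phi> (clt_sum n)) y"
        if "y > 0" for y using n that by (intro resolvent_mass_antimono) auto
    qed (use distribution_of_self_adjoint(1,2)[OF st self_adjoint_clt_sum K(1)]
             distribution_of_self_adjoint(1,2)[OF st self_adjoint_clt_sum K(2)] in auto)
  qed
qed

end
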